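(* Every symplectic Lie group bundle has a canonical $t$-symplectic Lie groupoid structure: if $(G,\omega,E,\pi,M,\widetilde{\omega})$ is a symplectic Lie group bundle, then the canonical Lie groupoid $E\rightrightarrows M$ determined by the fiberwise group structures, together with $\widetilde{\omega}$, is a $t$-symplectic Lie groupoid.
   Context: A symplectic Lie group $(G,\omega)$ is a Lie group $G$ with a left-invariant symplectic form $\omega$; an isomorphism of symplectic Lie groups is a Lie group isomorphism pulling back the target form to the source form. A symplectic Lie group bundle (SLGB) consists of data $(G,\omega,E,\pi,M,\widetilde{\omega})$, where (i) $(G,\omega)$ is a symplectic Lie group; (ii) $\pi:E\to M$ is a smooth fiber bundle with fiber $G$; (iii) $\widetilde{\omega}$ is a smooth section of $\wedge^2(\ker\pi_\ast)^\ast$; such that (a) for all $p\in M$ the fiber $E_p:=\pi^{-1}(p)$ has a Lie group structure (whose smooth structure is that of $E_p$ as an embedded submanifold of $E$); (b) for all $p\in M$, $\gamma_p^\ast\widetilde{\omega}$ is a left-invariant symplectic form on $E_p$, where $\gamma_p:T(E_p)\hookrightarrow\ker\pi_\ast$ is the inclusion; (c) there is a system of local trivializations $\{\psi_i:\pi^{-1}(U_i)\to U_i\times G\}$ such that for all $i$ and $p\in U_i$, $\psi_{i,p}:(E_p,\gamma_p^\ast\widetilde{\omega})\to(G,\omega)$ is an isomorphism of symplectic Lie groups, where $\psi_{i,p}$ is the composition $E_p\xrightarrow{\psi_i}\{p\}\times G\cong G$. The canonical groupoid $E\rightrightarrows M$: source and target $s=t:=\pi$; unit map $u(p):=1_p$,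 the identity element of $E_p$; multiplication and inverse given by the fiberwise group multiplication and inverse. A Lie groupoid $\mathcal{G}\rightrightarrows M$ is a groupoid with $\mathcal{G},M$ smooth manifolds, smooth structure maps, and source map $s$ a surjective submersion; $gh$ is defined when $s(g)=t(h)$, and $l_g:t^{-1}(s(g))\to t^{-1}(t(g))$ is left multiplication by $g$. Put $T^t\mathcal{G}:=\ker t_\ast$. A section $\widetilde{\omega}\in\Gamma(\wedge^2(T^t\mathcal{G})^\ast)$ is left-invariant if $(l_g)^\ast(\widetilde{\omega}|_{t^{-1}(t(g))})=\widetilde{\omega}|_{t^{-1}(s(g))}$ for all $g\in\mathcal{G}$. A $t$-symplectic Lie groupoid is a Lie groupoid with a left-invariant section $\widetilde{\omega}\in\Gamma(\wedge^2(T^t\mathcal{G})^\ast)$ such that $(t^{-1}(p),\widetilde{\omega}|_{t^{-1}(p)})$ is a symplectic manifold for all $p\in M$. *)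

theory Defs
  imports "HOL-Analysis.Analysis" "HOL-Algebra.Group"
begin

section \<open>Model spaces and smooth maps between them\<close>

text \<open>
  The model spaces are the finite-dimensional real inner product spaces. The library class
  \<open>euclidean_space\<close> is not used directly because it forces the dimension to be positive, which
  would exclude, for instance, the one-point base manifold.
\<close>

class model_space = real_inner +
  assumes finite_spanning: "\<exists>B. finite B \<and> (\<forall>x. \<exists>r. x = (\<Sum>b\<in>B. r b *\<^sub>R b))"

lemma finite_dimensional: "\<exists>B :: 'a::model_space set. finite B \<and> span B = UNIV"
proof -
  obtain B :: "'a set" where B: "finite B" "\<forall>x. \<exists>r. x = (\<Sum>b\<in>B. r b *\<^sub>R b)"
    using finite_spanning by blast
  then have "span B = UNIV"
    by (auto simp: span_finite)
  with B(1) show ?thesis by blast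
qed

lemma finite_spanningI:
  fixes B :: "'a::real_vector set"
  assumes "finite B" and "span B = UNIV"
  shows "\<exists>B :: 'a set. finite B \<and> (\<forall>x. \<exists>r. x = (\<Sum>b\<in>B. r b *\<^sub>R b))"
proof (rule exI [of _ B], intro conjI allI)
  show "finite B" by fact
  fix x :: 'a
  have "x \<in> range (\<lambda>r. \<Sum>b\<in>B. r b *\<^sub>R b)"
    using assms by (simp add: span_finite)
  then show "\<exists>r. x = (\<Sum>b\<in>B. r b *\<^sub>R b)" by auto
qed

subclass (in euclidean_space) model_space
proof
  show "\<exists>B. finite B \<and> (\<forall>x. \<exists>r. x = (\<Sum>b\<in>B. r b *\<^sub>R b))"
  proof (rule exI [of _ Basis], intro conjI allI)
    show "finite Basis" by (rule finite_Basis)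
    show "\<exists>r. x = (\<Sum>b\<in>Basis. r b *\<^sub>R b)" for x
      using euclidean_representation [of x, symmetric] by blast
  qed
qed

instance prod :: (model_space, model_space) model_space
proof
  obtain A :: "'a set" where A: "finite A" "span A = UNIV"
    using finite_dimensional by blast
  obtain B :: "'b set" where B: "finite B" "span B = UNIV"
    using finite_dimensional by blast
  let ?C = "(\<lambda>a. (a, 0)) ` A \<union> (\<lambda>b. (0, b)) ` B :: ('a \<times> 'b) set"
  have l1: "linear (\<lambda>a :: 'a. (a, 0 :: 'b))" and l2: "linear (\<lambda>b :: 'b. (0 :: 'a, b))"
    by (auto intro!: linearI)
  have "x \<in> span ?C" for x :: "'a \<times> 'b"
  proof -
    have "(fst x, 0) \<in> span ((\<lambda>a. (a, 0 :: 'b)) ` A)"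
      using A(2) linear_span_image [OF l1, of A] by auto
    moreover have "(0, snd x) \<in> span ((\<lambda>b. (0 :: 'a, b)) ` B)"
      using B(2) linear_span_image [OF l2, of B] by auto
    ultimately have "(fst x, 0) + (0, snd x) \<in> span ?C"
      by (meson span_add span_mono subsetD Un_upper1 Un_upper2)
    then show ?thesis by simp
  qed
  then show "\<exists>C :: ('a \<times> 'b) set. finite C \<and> (\<forall>x. \<exists>r. x = (\<Sum>c\<in>C. r c *\<^sub>R c))"
    using A(1) B(1) by (intro finite_spanningI [of ?C]) auto
qed

text \<open>A model space of dimension zero.\<close>

datatype zero_space = Zero_Space

lemma zero_space_eq: "x = (y :: zero_space)"
  by (cases x; cases y) simp

instantiation zero_space :: real_inner
begin

definition zero_zero_space :: zero_space where "zero_zero_space = Zero_Space"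
definition plus_zero_space :: "zero_space \<Rightarrow> zero_space \<Rightarrow> zero_space"
  where "plus_zero_space x y = Zero_Space"
definition minus_zero_space :: "zero_space \<Rightarrow> zero_space \<Rightarrow> zero_space"
  where "minus_zero_space x y = Zero_Space"
definition uminus_zero_space :: "zero_space \<Rightarrow> zero_space"
  where "uminus_zero_space x = Zero_Space"
definition scaleR_zero_space :: "real \<Rightarrow> zero_space \<Rightarrow> zero_space"
  where "scaleR_zero_space r x = Zero_Space"
definition sgn_zero_space :: "zero_space \<Rightarrow> zero_space"
  where "sgn_zero_space x = Zero_Space"
definition inner_zero_space :: "zero_space \<Rightarrow> zero_space \<Rightarrow> real"
  where "inner_zero_space x y = 0"
definition norm_zero_space :: "zero_space \<Rightarrow> real"
  where "norm_zero_space x = 0"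
definition dist_zero_space :: "zero_space \<Rightarrow> zero_space \<Rightarrow> real"
  where "dist_zero_space x y = 0"
definition uniformity_zero_space :: "(zero_space \<times> zero_space) filter"
  where "uniformity_zero_space = (INF e\<in>{0 <..}. principal {(x, y). dist x y < e})"
definition open_zero_space :: "zero_space set \<Rightarrow> bool"
  where "open_zero_space U \<longleftrightarrow> (\<forall>x\<in>U. eventually (\<lambda>(x', y). x' = x \<longrightarrow> y \<in> U) uniformity)"

instance
  by standard
    (auto simp: zero_zero_space_def plus_zero_space_def minus_zero_space_def
      uminus_zero_space_def scaleR_zero_space_def sgn_zero_space_def inner_zero_space_def
      norm_zero_space_def dist_zero_space_def uniformity_zero_space_def open_zero_space_def
      intro: zero_space_eq)

end

instance zero_space :: model_space
proof
  show "\<exists>B :: zero_space set. finite B \<and> (\<forall>x. \<exists>r. x = (\<Sum>b\<in>B. r b *\<^sub>R b))"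
    by (rule exI [of _ "{}"]) (auto intro: zero_space_eq)
qed

text \<open>Only used for open \<open>S\<close>; then this is the usual notion of a map of class \<open>C\<^sup>k\<close>.\<close>

primrec Ck_on ::
  "nat \<Rightarrow> 'a::real_normed_vector set \<Rightarrow> ('a \<Rightarrow> 'b::real_normed_vector) \<Rightarrow> bool" where
  "Ck_on 0 S f \<longleftrightarrow> continuous_on S f"
| "Ck_on (Suc k) S f \<longleftrightarrow> (\<forall>x\<in>S. f differentiable (at x)) \<and>
     (\<forall>v. Ck_on k S (\<lambda>x. frechet_derivative f (at x) v))"

definition smooth_on ::
  "'a::real_normed_vector set \<Rightarrow> ('a \<Rightarrow> 'b::real_normed_vector) \<Rightarrow> bool" where
  "smooth_on S f \<longleftrightarrow> (\<forall>k. Ck_on k S f)"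

section \<open>Smooth manifolds\<close>

text \<open>
  A chart is a pair of a domain and a coordinate map, whose values outside the domain are
  irrelevant. A manifold is given by an atlas; its underlying set is the union of the chart
  domains and its topology is the one induced by the charts.
\<close>

type_synonym ('a, 'e) chart = "'a set \<times> ('a \<Rightarrow> 'e)"
type_synonym ('a, 'e) atlas = "('a, 'e) chart set"

definition chart :: "('a, 'e::model_space) chart \<Rightarrow> bool" where
  "chart c \<longleftrightarrow> inj_on (snd c) (fst c) \<and> open (snd c ` fst c)"

definition chart_inv :: "('a, 'e) chart \<Rightarrow> 'e \<Rightarrow> 'a" where
  "chart_inv c = inv_into (fst c) (snd c)"

definition transition :: "('a, 'e) chart \<Rightarrow> ('a, 'e) chart \<Rightarrow> 'e \<Rightarrow> 'e" where
  "transition c c' = snd c' \<circ> chart_inv c"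

definition compatible :: "('a, 'e::model_space) chart \<Rightarrow> ('a, 'e) chart \<Rightarrow> bool" where
  "compatible c c' \<longleftrightarrow>
     open (snd c ` (fst c \<inter> fst c')) \<and> open (snd c' ` (fst c \<inter> fst c')) \<and>
     smooth_on (snd c ` (fst c \<inter> fst c')) (transition c c') \<and>
     smooth_on (snd c' ` (fst c \<inter> fst c')) (transition c' c)"

definition atlas :: "('a, 'e::model_space) atlas \<Rightarrow> bool" where
  "atlas A \<longleftrightarrow> (\<forall>c\<in>A. chart c) \<and> (\<forall>c\<in>A. \<forall>c'\<in>A. compatible c c')"

definition mcarrier :: "('a, 'e) atlas \<Rightarrow> 'a set" where
  "mcarrier A = (\<Union>c\<in>A. fst c)"

definition mtopology :: "('a, 'e::model_space) atlas \<Rightarrow> 'a topology" where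
  "mtopology A = topology (\<lambda>S. S \<subseteq> mcarrier A \<and> (\<forall>c\<in>A. open (snd c ` (S \<inter> fst c))))"

lemma openin_mtopology:
  assumes "atlas A"
  shows "openin (mtopology A) S \<longleftrightarrow>
    S \<subseteq> mcarrier A \<and> (\<forall>c\<in>A. open (snd c ` (S \<inter> fst c)))"
proof -
  have "istopology (\<lambda>S. S \<subseteq> mcarrier A \<and> (\<forall>c\<in>A. open (snd c ` (S \<inter> fst c))))"
    unfolding istopology_def
  proof (intro conjI allI impI, goal_cases)
    case (1 S T)
    then show ?case by auto
  next
    case (2 S T)
    have "open (snd c ` (S \<inter> T \<inter> fst c))" if "c \<in> A" for c
    proof -
      have "inj_on (snd c) (fst c)"
        using assms that by (auto simp: atlas_def chart_def)
      then have "snd c ` (S \<inter> T \<inter> fst c) = snd c ` (S \<inter> fst c) \<inter> snd c ` (T \<inter> fst c)"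
        by (auto simp: inj_on_def)
      with 2 that show ?thesis by auto
    qed
    then show ?case by auto
  next
    case (3 K)
    then show ?case by auto
  next
    case (4 K)
    have "open (snd c ` (\<Union>K \<inter> fst c))" if "c \<in> A" for c
    proof -
      have "snd c ` (\<Union>K \<inter> fst c) = (\<Union>S\<in>K. snd c ` (S \<inter> fst c))" by auto
      with 4 that show ?thesis by auto
    qed
    then show ?case by auto
  qed
  then show ?thesis
    by (simp add: mtopology_def topology_inverse')
qed

definition smooth_manifold :: "('a, 'e::model_space) atlas \<Rightarrow> bool" where
  "smooth_manifold A \<longleftrightarrow>
     atlas A \<and> Hausdorff_space (mtopology A) \<and> second_countable (mtopology A)"

definition smooth_map ::
  "('a, 'e::model_space) atlas \<Rightarrow> ('b, 'f::model_space) atlas \<Rightarrow> ('a \<Rightarrow> 'b) \<Rightarrow> bool" where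
  "smooth_map A B f \<longleftrightarrow> continuous_map (mtopology A) (mtopology B) f \<and>
     (\<forall>c\<in>A. \<forall>c'\<in>B. smooth_on (snd c ` (fst c \<inter> f -` fst c')) (snd c' \<circ> f \<circ> chart_inv c))"

definition diffeomorphism ::
  "('a, 'e::model_space) atlas \<Rightarrow> ('b, 'f::model_space) atlas \<Rightarrow> ('a \<Rightarrow> 'b) \<Rightarrow> bool" where
  "diffeomorphism A B f \<longleftrightarrow> bij_betw f (mcarrier A) (mcarrier B) \<and>
     smooth_map A B f \<and> smooth_map B A (inv_into (mcarrier A) f)"

definition prod_atlas :: "('a, 'e) atlas \<Rightarrow> ('b, 'f) atlas \<Rightarrow> ('a \<times> 'b, 'e \<times> 'f) atlas" where
  "prod_atlas A B = {(fst c \<times> fst c', map_prod (snd c) (snd c')) | c c'. c \<in> A \<and> c' \<in> B}"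

text \<open>The open submanifold with underlying set \<open>S\<close>.\<close>

definition restrict_atlas :: "('a, 'e) atlas \<Rightarrow> 'a set \<Rightarrow> ('a, 'e) atlas" where
  "restrict_atlas A S = {(fst c \<inter> S, snd c) | c. c \<in> A}"

section \<open>Embedded submanifolds\<close>

definition max_atlas :: "('a, 'e::model_space) atlas \<Rightarrow> ('a, 'e) atlas" where
  "max_atlas A = {c. chart c \<and> fst c \<subseteq> mcarrier A \<and> (\<forall>c'\<in>A. compatible c c')}"

text \<open>
  A slice chart for \<open>S\<close> is a chart of the maximal atlas in which \<open>S\<close> corresponds to a linear
  subspace, given as the image of an injective linear map \<open>j\<close> from the model space of \<open>S\<close>;
  it induces a chart of \<open>S\<close>. These induced charts form the smooth structure of \<open>S\<close>
  as an embedded submanifold.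
\<close>

definition slice_chart ::
  "('a, 'e::model_space) atlas \<Rightarrow> 'a set \<Rightarrow> ('a, 'e) chart \<Rightarrow> ('k::model_space \<Rightarrow> 'e) \<Rightarrow> bool" where
  "slice_chart A S c j \<longleftrightarrow> c \<in> max_atlas A \<and> linear j \<and> inj j \<and>
     snd c ` (fst c \<inter> S) = snd c ` fst c \<inter> range j"

definition submanifold_atlas ::
  "('a, 'e::model_space) atlas \<Rightarrow> 'a set \<Rightarrow> ('a, 'k::model_space) atlas" where
  "submanifold_atlas A S = {(fst c \<inter> S, inv_into UNIV j \<circ> snd c) | c j. slice_chart A S c j}"

definition embedded_submanifold ::
  "'k::model_space itself \<Rightarrow> ('a, 'e::model_space) atlas \<Rightarrow> 'a set \<Rightarrow> bool" where
  "embedded_submanifold TYPE('k) A S \<longleftrightarrow> S \<subseteq> mcarrier A \<and>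
     (\<forall>x\<in>S. \<exists>c. \<exists>j :: 'k \<Rightarrow> 'e. slice_chart A S c j \<and> x \<in> fst c)"

section \<open>Tangent vectors and differentials\<close>

text \<open>
  A tangent vector at \<open>p\<close> is the family of its coordinate vectors in all charts of the atlas
  around \<open>p\<close>, transforming by the derivatives of the transition maps; it is set to \<open>0\<close> on all
  other pairs of type \<open>chart\<close> so that equality of functions is equality of tangent vectors.
\<close>

type_synonym ('a, 'e) tvec = "('a, 'e) chart \<Rightarrow> 'e"

definition charts_at :: "('a, 'e) atlas \<Rightarrow> 'a \<Rightarrow> ('a, 'e) chart set" where
  "charts_at A p = {c \<in> A. p \<in> fst c}"

definition tangent_space :: "('a, 'e::model_space) atlas \<Rightarrow> 'a \<Rightarrow> ('a, 'e) tvec set" where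
  "tangent_space A p = {v.
     (\<forall>c\<in>charts_at A p. \<forall>c'\<in>charts_at A p.
        v c' = frechet_derivative (transition c c') (at (snd c p)) (v c)) \<and>
     (\<forall>c. c \<notin> charts_at A p \<longrightarrow> v c = 0)}"

definition coord_tvec ::
  "('a, 'e::model_space) atlas \<Rightarrow> ('a, 'e) chart \<Rightarrow> 'a \<Rightarrow> 'e \<Rightarrow> ('a, 'e) tvec" where
  "coord_tvec A c p u = (\<lambda>c'. if c' \<in> charts_at A p
     then frechet_derivative (transition c c') (at (snd c p)) u else 0)"

text \<open>The differential of \<open>f\<close> at \<open>p\<close>; the result does not depend on the chosen chart.\<close>

definition tangent_map ::
  "('a, 'e::model_space) atlas \<Rightarrow> ('b, 'f::model_space) atlas \<Rightarrow> ('a \<Rightarrow> 'b) \<Rightarrow> 'a \<Rightarrow>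
   ('a, 'e) tvec \<Rightarrow> ('b, 'f) tvec" where
  "tangent_map A B f p v = (let c = (SOME c. c \<in> charts_at A p) in
     (\<lambda>c'. if c' \<in> charts_at B (f p)
       then frechet_derivative (snd c' \<circ> f \<circ> chart_inv c) (at (snd c p)) (v c) else 0))"

definition ker_tangent ::
  "('a, 'e::model_space) atlas \<Rightarrow> ('b, 'f::model_space) atlas \<Rightarrow> ('a \<Rightarrow> 'b) \<Rightarrow> 'a \<Rightarrow>
   ('a, 'e) tvec set" where
  "ker_tangent A B f p = {v \<in> tangent_space A p. tangent_map A B f p v = (\<lambda>_. 0)}"

definition submersion ::
  "('a, 'e::model_space) atlas \<Rightarrow> ('b, 'f::model_space) atlas \<Rightarrow> ('a \<Rightarrow> 'b) \<Rightarrow> bool" where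
  "submersion A B f \<longleftrightarrow> smooth_map A B f \<and>
     (\<forall>p\<in>mcarrier A. tangent_map A B f p ` tangent_space A p = tangent_space B (f p))"

section \<open>Two-forms\<close>

text \<open>
  \<open>D\<close> assigns to each point a subspace of the tangent space. It is either the whole
  tangent bundle or the kernel of the differential of a submersion. A section of
  \<open>\<And>\<^sup>2 D\<^sup>*\<close> is only constrained on \<open>D\<close>; its other values are irrelevant.
\<close>

type_synonym ('a, 'e) form2 = "'a \<Rightarrow> ('a, 'e) tvec \<Rightarrow> ('a, 'e) tvec \<Rightarrow> real"

definition alternating_bilinear :: "('a, 'e::model_space) tvec set \<Rightarrow>
   (('a, 'e) tvec \<Rightarrow> ('a, 'e) tvec \<Rightarrow> real) \<Rightarrow> bool" where
  "alternating_bilinear V b \<longleftrightarrow>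
     (\<forall>u\<in>V. \<forall>v\<in>V. \<forall>w\<in>V. \<forall>r s.
        b (\<lambda>c. r *\<^sub>R u c + s *\<^sub>R v c) w = r * b u w + s * b v w \<and>
        b w (\<lambda>c. r *\<^sub>R u c + s *\<^sub>R v c) = r * b w u + s * b w v) \<and>
     (\<forall>u\<in>V. b u u = 0)"

definition smooth_function_on :: "('a, 'e::model_space) atlas \<Rightarrow> 'a set \<Rightarrow> ('a \<Rightarrow> real) \<Rightarrow> bool" where
  "smooth_function_on A S h \<longleftrightarrow> (\<forall>c\<in>A. smooth_on (snd c ` (S \<inter> fst c)) (h \<circ> chart_inv c))"

definition smooth_vector_field_on :: "('a, 'e::model_space) atlas \<Rightarrow> ('a \<Rightarrow> ('a, 'e) tvec set) \<Rightarrow>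
   'a set \<Rightarrow> ('a \<Rightarrow> ('a, 'e) tvec) \<Rightarrow> bool" where
  "smooth_vector_field_on A D S X \<longleftrightarrow> (\<forall>p\<in>S. X p \<in> D p) \<and>
     (\<forall>c\<in>A. smooth_on (snd c ` (S \<inter> fst c)) (\<lambda>x. X (chart_inv c x) c))"

definition smooth_section2 ::
  "('a, 'e::model_space) atlas \<Rightarrow> ('a \<Rightarrow> ('a, 'e) tvec set) \<Rightarrow> ('a, 'e) form2 \<Rightarrow> bool" where
  "smooth_section2 A D \<omega> \<longleftrightarrow> (\<forall>p\<in>mcarrier A. alternating_bilinear (D p) (\<omega> p)) \<and>
     (\<forall>S X Y. openin (mtopology A) S \<longrightarrow>
        smooth_vector_field_on A D S X \<longrightarrow> smooth_vector_field_on A D S Y \<longrightarrow>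
        smooth_function_on A S (\<lambda>p. \<omega> p (X p) (Y p)))"

definition pullback2 :: "('a, 'e::model_space) atlas \<Rightarrow> ('b, 'f::model_space) atlas \<Rightarrow>
   ('a \<Rightarrow> 'b) \<Rightarrow> ('b, 'f) form2 \<Rightarrow> ('a, 'e) form2" where
  "pullback2 A B f \<omega> = (\<lambda>p u v. \<omega> (f p) (tangent_map A B f p u) (tangent_map A B f p v))"

definition form2_eq ::
  "('a, 'e::model_space) atlas \<Rightarrow> ('a, 'e) form2 \<Rightarrow> ('a, 'e) form2 \<Rightarrow> bool" where
  "form2_eq A \<omega> \<eta> \<longleftrightarrow>
     (\<forall>p\<in>mcarrier A. \<forall>u\<in>tangent_space A p. \<forall>v\<in>tangent_space A p. \<omega> p u v = \<eta> p u v)"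

definition coord_form2 ::
  "('a, 'e::model_space) atlas \<Rightarrow> ('a, 'e) form2 \<Rightarrow> ('a, 'e) chart \<Rightarrow> 'e \<Rightarrow> 'e \<Rightarrow> 'e \<Rightarrow> real" where
  "coord_form2 A \<omega> c x u v =
     (let p = chart_inv c x in \<omega> p (coord_tvec A c p u) (coord_tvec A c p v))"

text \<open>The left-hand side below is the exterior derivative in coordinates, on constant fields.\<close>

definition closed_form2 :: "('a, 'e::model_space) atlas \<Rightarrow> ('a, 'e) form2 \<Rightarrow> bool" where
  "closed_form2 A \<omega> \<longleftrightarrow> (\<forall>c\<in>A. \<forall>x\<in>snd c ` fst c. \<forall>u v w.
       frechet_derivative (\<lambda>y. coord_form2 A \<omega> c y v w) (at x) u
     - frechet_derivative (\<lambda>y. coord_form2 A \<omega> c y u w) (at x) v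
     + frechet_derivative (\<lambda>y. coord_form2 A \<omega> c y u v) (at x) w = 0)"

definition nondegenerate_form2 :: "('a, 'e::model_space) atlas \<Rightarrow> ('a, 'e) form2 \<Rightarrow> bool" where
  "nondegenerate_form2 A \<omega> \<longleftrightarrow> (\<forall>p\<in>mcarrier A. \<forall>u\<in>tangent_space A p.
     (\<forall>v\<in>tangent_space A p. \<omega> p u v = 0) \<longrightarrow> u = (\<lambda>_. 0))"

definition symplectic_form :: "('a, 'e::model_space) atlas \<Rightarrow> ('a, 'e) form2 \<Rightarrow> bool" where
  "symplectic_form A \<omega> \<longleftrightarrow> smooth_section2 A (tangent_space A) \<omega> \<and>
     closed_form2 A \<omega> \<and> nondegenerate_form2 A \<omega>"

definition symplectic_manifold :: "('a, 'e::model_space) atlas \<Rightarrow> ('a, 'e) form2 \<Rightarrow> bool" where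
  "symplectic_manifold A \<omega> \<longleftrightarrow> smooth_manifold A \<and> symplectic_form A \<omega>"

section \<open>Symplectic Lie groups\<close>

definition lie_group :: "('a, 'e::model_space) atlas \<Rightarrow> 'a monoid \<Rightarrow> bool" where
  "lie_group A G \<longleftrightarrow> smooth_manifold A \<and> group G \<and> carrier G = mcarrier A \<and>
     smooth_map (prod_atlas A A) A (\<lambda>(x, y). x \<otimes>\<^bsub>G\<^esub> y) \<and>
     smooth_map A A (\<lambda>x. inv\<^bsub>G\<^esub> x)"

definition left_invariant_form ::
  "('a, 'e::model_space) atlas \<Rightarrow> 'a monoid \<Rightarrow> ('a, 'e) form2 \<Rightarrow> bool" where
  "left_invariant_form A G \<omega> \<longleftrightarrow>
     (\<forall>g\<in>carrier G. form2_eq A (pullback2 A A (\<lambda>x. g \<otimes>\<^bsub>G\<^esub> x) \<omega>) \<omega>)"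

definition symplectic_lie_group ::
  "('a, 'e::model_space) atlas \<Rightarrow> 'a monoid \<Rightarrow> ('a, 'e) form2 \<Rightarrow> bool" where
  "symplectic_lie_group A G \<omega> \<longleftrightarrow>
     lie_group A G \<and> symplectic_form A \<omega> \<and> left_invariant_form A G \<omega>"

definition symplectic_lie_group_iso ::
  "('a, 'e::model_space) atlas \<Rightarrow> 'a monoid \<Rightarrow> ('a, 'e) form2 \<Rightarrow>
   ('b, 'f::model_space) atlas \<Rightarrow> 'b monoid \<Rightarrow> ('b, 'f) form2 \<Rightarrow> ('a \<Rightarrow> 'b) \<Rightarrow> bool" where
  "symplectic_lie_group_iso A G \<omega> B H \<eta> f \<longleftrightarrow>
     f \<in> iso G H \<and> diffeomorphism A B f \<and> form2_eq A (pullback2 A B f \<eta>) \<omega>"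

section \<open>Symplectic Lie group bundles\<close>

definition fiber :: "('a, 'e) atlas \<Rightarrow> ('a \<Rightarrow> 'b) \<Rightarrow> 'b \<Rightarrow> 'a set" where
  "fiber A f p = {x \<in> mcarrier A. f x = p}"

definition local_trivialization ::
  "('x, 'e::model_space) atlas \<Rightarrow> ('x \<Rightarrow> 'b) \<Rightarrow> ('b, 'm::model_space) atlas \<Rightarrow>
   ('g, 'n::model_space) atlas \<Rightarrow> 'b set \<Rightarrow> ('x \<Rightarrow> 'b \<times> 'g) \<Rightarrow> bool" where
  "local_trivialization E \<pi> M F U \<psi> \<longleftrightarrow> openin (mtopology M) U \<and>
     diffeomorphism (restrict_atlas E {x \<in> mcarrier E. \<pi> x \<in> U})
       (prod_atlas (restrict_atlas M U) F) \<psi> \<and>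
     (\<forall>x\<in>mcarrier E. \<pi> x \<in> U \<longrightarrow> fst (\<psi> x) = \<pi> x)"

definition smooth_fiber_bundle ::
  "('x, 'e::model_space) atlas \<Rightarrow> ('x \<Rightarrow> 'b) \<Rightarrow> ('b, 'm::model_space) atlas \<Rightarrow>
   ('g, 'n::model_space) atlas \<Rightarrow> bool" where
  "smooth_fiber_bundle E \<pi> M F \<longleftrightarrow>
     smooth_manifold E \<and> smooth_manifold M \<and> smooth_manifold F \<and>
     smooth_map E M \<pi> \<and> \<pi> ` mcarrier E = mcarrier M \<and>
     (\<forall>p\<in>mcarrier M. \<exists>U \<psi>. p \<in> U \<and> local_trivialization E \<pi> M F U \<psi>)"

text \<open>The restriction of \<open>\<omega>\<close> to an embedded submanifold, i.e. its pullback by the inclusion.\<close>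

definition restrict_form2 ::
  "('a, 'e::model_space) atlas \<Rightarrow> 'a set \<Rightarrow> ('a, 'e) form2 \<Rightarrow> ('a, 'k::model_space) form2" where
  "restrict_form2 A S \<omega> = pullback2 (submanifold_atlas A S) A (\<lambda>x. x) \<omega>"

text \<open>
  \<open>GA\<close> and \<open>G\<close> are the smooth and the group structure of the fiber, and \<open>grp p\<close> is the group
  structure on the fiber over \<open>p\<close>, which is part of the data.
\<close>

definition symplectic_lie_group_bundle ::
  "('g, 'n::model_space) atlas \<Rightarrow> 'g monoid \<Rightarrow> ('g, 'n) form2 \<Rightarrow>
   ('x, 'e::model_space) atlas \<Rightarrow> ('x \<Rightarrow> 'b) \<Rightarrow> ('b, 'm::model_space) atlas \<Rightarrow>
   ('b \<Rightarrow> 'x monoid) \<Rightarrow> ('x, 'e) form2 \<Rightarrow> bool" where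
  "symplectic_lie_group_bundle GA G \<omega> E \<pi> M grp \<omega>' \<longleftrightarrow>
     symplectic_lie_group GA G \<omega> \<and>
     smooth_fiber_bundle E \<pi> M GA \<and>
     smooth_section2 E (ker_tangent E M \<pi>) \<omega>' \<and>
     (\<forall>p\<in>mcarrier M.
        carrier (grp p) = fiber E \<pi> p \<and>
        embedded_submanifold TYPE('n) E (fiber E \<pi> p) \<and>
        lie_group (submanifold_atlas E (fiber E \<pi> p) :: ('x, 'n) atlas) (grp p)) \<and>
     (\<forall>p\<in>mcarrier M.
        symplectic_form (submanifold_atlas E (fiber E \<pi> p) :: ('x, 'n) atlas)
          (restrict_form2 E (fiber E \<pi> p) \<omega>') \<and>
        left_invariant_form (submanifold_atlas E (fiber E \<pi> p) :: ('x, 'n) atlas) (grp p)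
          (restrict_form2 E (fiber E \<pi> p) \<omega>')) \<and>
     (\<exists>T. (\<Union>(U, \<psi>)\<in>T. U) = mcarrier M \<and>
        (\<forall>(U, \<psi>)\<in>T. local_trivialization E \<pi> M GA U \<psi> \<and>
           (\<forall>p\<in>U. symplectic_lie_group_iso
              (submanifold_atlas E (fiber E \<pi> p) :: ('x, 'n) atlas) (grp p)
              (restrict_form2 E (fiber E \<pi> p) \<omega>') GA G \<omega> (\<lambda>x. snd (\<psi> x)))))"

section \<open>Lie groupoids\<close>

record ('a, 'e, 'o, 'm) groupoid_data =
  arr :: "('a, 'e) atlas"
  obj :: "('o, 'm) atlas"
  src :: "'a \<Rightarrow> 'o"
  tgt :: "'a \<Rightarrow> 'o"
  idt :: "'o \<Rightarrow> 'a"
  mul :: "'a \<Rightarrow> 'a \<Rightarrow> 'a"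
  ivs :: "'a \<Rightarrow> 'a"

definition composable :: "('a, 'e, 'o, 'm) groupoid_data \<Rightarrow> ('a \<times> 'a) set" where
  "composable \<Gamma> = {(g, h). g \<in> mcarrier (arr \<Gamma>) \<and> h \<in> mcarrier (arr \<Gamma>) \<and> src \<Gamma> g = tgt \<Gamma> h}"

definition groupoid :: "('a, 'e, 'o, 'm) groupoid_data \<Rightarrow> bool" where
  "groupoid \<Gamma> \<longleftrightarrow>
     (\<forall>g\<in>mcarrier (arr \<Gamma>). src \<Gamma> g \<in> mcarrier (obj \<Gamma>) \<and> tgt \<Gamma> g \<in> mcarrier (obj \<Gamma>)) \<and>
     (\<forall>p\<in>mcarrier (obj \<Gamma>). idt \<Gamma> p \<in> mcarrier (arr \<Gamma>) \<and>
        src \<Gamma> (idt \<Gamma> p) = p \<and> tgt \<Gamma> (idt \<Gamma> p) = p) \<and>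
     (\<forall>(g, h)\<in>composable \<Gamma>. mul \<Gamma> g h \<in> mcarrier (arr \<Gamma>) \<and>
        src \<Gamma> (mul \<Gamma> g h) = src \<Gamma> h \<and> tgt \<Gamma> (mul \<Gamma> g h) = tgt \<Gamma> g) \<and>
     (\<forall>g h k. (g, h) \<in> composable \<Gamma> \<longrightarrow> (h, k) \<in> composable \<Gamma> \<longrightarrow>
        mul \<Gamma> (mul \<Gamma> g h) k = mul \<Gamma> g (mul \<Gamma> h k)) \<and>
     (\<forall>g\<in>mcarrier (arr \<Gamma>).
        mul \<Gamma> (idt \<Gamma> (tgt \<Gamma> g)) g = g \<and> mul \<Gamma> g (idt \<Gamma> (src \<Gamma> g)) = g) \<and>
     (\<forall>g\<in>mcarrier (arr \<Gamma>). ivs \<Gamma> g \<in> mcarrier (arr \<Gamma>) \<and>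
        src \<Gamma> (ivs \<Gamma> g) = tgt \<Gamma> g \<and> tgt \<Gamma> (ivs \<Gamma> g) = src \<Gamma> g \<and>
        mul \<Gamma> g (ivs \<Gamma> g) = idt \<Gamma> (tgt \<Gamma> g) \<and> mul \<Gamma> (ivs \<Gamma> g) g = idt \<Gamma> (src \<Gamma> g))"

text \<open>
  The type argument \<open>'f\<close> is the model space of the target fibers; the manifold of composable
  pairs then has dimension \<open>dim M + 2 dim 'f\<close>. It is an embedded submanifold automatically, the
  source being a submersion; the explicit condition only fixes the dimension of \<open>'f\<close>.
\<close>

definition lie_groupoid ::
  "'f::model_space itself \<Rightarrow> ('a, 'e::model_space, 'o, 'm::model_space) groupoid_data \<Rightarrow> bool" where
  "lie_groupoid TYPE('f) \<Gamma> \<longleftrightarrow>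
     smooth_manifold (arr \<Gamma>) \<and> smooth_manifold (obj \<Gamma>) \<and> groupoid \<Gamma> \<and>
     submersion (arr \<Gamma>) (obj \<Gamma>) (src \<Gamma>) \<and>
     src \<Gamma> ` mcarrier (arr \<Gamma>) = mcarrier (obj \<Gamma>) \<and>
     smooth_map (arr \<Gamma>) (obj \<Gamma>) (tgt \<Gamma>) \<and>
     smooth_map (obj \<Gamma>) (arr \<Gamma>) (idt \<Gamma>) \<and>
     smooth_map (arr \<Gamma>) (arr \<Gamma>) (ivs \<Gamma>) \<and>
     embedded_submanifold TYPE('m \<times> 'f \<times> 'f) (prod_atlas (arr \<Gamma>) (arr \<Gamma>)) (composable \<Gamma>) \<and>
     smooth_map
       (submanifold_atlas (prod_atlas (arr \<Gamma>) (arr \<Gamma>)) (composable \<Gamma>)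
          :: ('a \<times> 'a, 'm \<times> 'f \<times> 'f) atlas)
       (arr \<Gamma>) (\<lambda>(g, h). mul \<Gamma> g h)"

definition target_fiber :: "('a, 'e, 'o, 'm) groupoid_data \<Rightarrow> 'o \<Rightarrow> 'a set" where
  "target_fiber \<Gamma> p = fiber (arr \<Gamma>) (tgt \<Gamma>) p"

definition left_invariant_section :: "'f::model_space itself \<Rightarrow>
   ('a, 'e::model_space, 'o, 'm::model_space) groupoid_data \<Rightarrow> ('a, 'e) form2 \<Rightarrow> bool" where
  "left_invariant_section TYPE('f) \<Gamma> \<omega> \<longleftrightarrow> (\<forall>g\<in>mcarrier (arr \<Gamma>).
     let S = target_fiber \<Gamma> (src \<Gamma> g); T = target_fiber \<Gamma> (tgt \<Gamma> g);
         AS = (submanifold_atlas (arr \<Gamma>) S :: ('a, 'f) atlas);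
         AT = (submanifold_atlas (arr \<Gamma>) T :: ('a, 'f) atlas)
     in form2_eq AS (pullback2 AS AT (\<lambda>h. mul \<Gamma> g h) (restrict_form2 (arr \<Gamma>) T \<omega>))
          (restrict_form2 (arr \<Gamma>) S \<omega>))"

definition t_symplectic_lie_groupoid :: "'f::model_space itself \<Rightarrow>
   ('a, 'e::model_space, 'o, 'm::model_space) groupoid_data \<Rightarrow> ('a, 'e) form2 \<Rightarrow> bool" where
  "t_symplectic_lie_groupoid TYPE('f) \<Gamma> \<omega> \<longleftrightarrow>
     lie_groupoid TYPE('f) \<Gamma> \<and>
     smooth_section2 (arr \<Gamma>) (ker_tangent (arr \<Gamma>) (obj \<Gamma>) (tgt \<Gamma>)) \<omega> \<and>
     left_invariant_section TYPE('f) \<Gamma> \<omega> \<and>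
     (\<forall>p\<in>mcarrier (obj \<Gamma>).
        embedded_submanifold TYPE('f) (arr \<Gamma>) (target_fiber \<Gamma> p) \<and>
        symplectic_manifold (submanifold_atlas (arr \<Gamma>) (target_fiber \<Gamma> p) :: ('a, 'f) atlas)
          (restrict_form2 (arr \<Gamma>) (target_fiber \<Gamma> p) \<omega>))"

definition canonical_groupoid :: "('x, 'e) atlas \<Rightarrow> ('x \<Rightarrow> 'b) \<Rightarrow> ('b, 'm) atlas \<Rightarrow>
   ('b \<Rightarrow> 'x monoid) \<Rightarrow> ('x, 'e, 'b, 'm) groupoid_data" where
  "canonical_groupoid E \<pi> M grp =
     \<lparr>arr = E, obj = M, src = \<pi>, tgt = \<pi>, idt = (\<lambda>p. \<one>\<^bsub>grp p\<^esub>),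
      mul = (\<lambda>g h. g \<otimes>\<^bsub>grp (\<pi> g)\<^esub> h), ivs = (\<lambda>g. inv\<^bsub>grp (\<pi> g)\<^esub> g)\<rparr>"

end

theory Submission
  imports Defs
begin

text \<open>
  In the canonical groupoid source and target are both \<open>\<pi>\<close>. So the target fibres are the fibres
  \<open>E\<^sub>p\<close>, arrows are composable exactly if they lie in the same fibre, and left multiplication by an
  arrow \<open>g\<close> is left translation by \<open>g\<close> in the group \<open>E\<^sub>p\<close> with \<open>p = \<pi> g\<close>. The groupoid axioms are
  therefore the group axioms in each fibre (\<open>groupoid_of_fiber_groups\<close>), and the conditions on the
  form say what is known of its restrictions to the fibres: they are left-invariant and symplectic.

  What remains is that the groupoid is a Lie groupoid. All parts of this are local on \<open>M\<close>, and over
  the domain of a trivialization \<open>\<psi>\<close> by group isomorphisms \<open>E\<^sub>p \<cong> G\<close> the bundle is the product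
  \<open>U \<times> G\<close>, in which the structure maps are \<open>p \<mapsto> (p, 1)\<close>, \<open>(p, h) \<mapsto> (p, h\<inverse>)\<close> and
  \<open>((p, h), (p, h')) \<mapsto> (p, h h')\<close>; see \<open>unit_eq\<close>, \<open>inverse_eq\<close> and \<open>mult_eq\<close>. They are smooth because
  \<open>G\<close> is a Lie group and \<open>\<psi>\<close> is a diffeomorphism. The projection is a submersion because it has
  smooth local sections through every point (\<open>tangent_map_surj_of_local_section\<close>).

  The composable pairs form the fibre product of \<open>E\<close> with itself over \<open>M\<close>. In charts of \<open>E\<close> made of
  one chart of \<open>M\<close> and charts of \<open>G\<close>, it is the linear subspace on which the two base coordinates
  agree, hence an embedded submanifold of dimension \<open>dim M + 2 dim G\<close>
  (\<open>slice_chart_fiber_product\<close>). Such a chart takes its values in the product of the model spaces of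
  \<open>M\<close> and \<open>G\<close>, which is not literally the model space of \<open>E\<close>; the differential of \<open>\<psi>\<close> provides a
  linear isomorphism (\<open>linear_iso_of_local_diffeo\<close>).

  To work with such local expressions, smoothness is expressed pointwise by \<open>smooth_at\<close>, which does
  not depend on the charts used, is stable under composition and pairing, and is insensitive to
  passing to open submanifolds. A map is smooth if and only if it is smooth at each point
  (\<open>smooth_map_iff_smooth_at\<close>).
\<close>

section \<open>Calculus on model spaces\<close>

text \<open>
  An orthogonal spanning set turns the coordinates of a vector into inner products, which are
  bounded linear. All uses of finite dimension in the calculus below go through this expansion.
\<close>

lemma model_space_expansion:
  "\<exists>(B :: 'a::model_space set) r. finite B \<and> (\<forall>b. bounded_linear (r b)) \<and>
     (\<forall>x. x = (\<Sum>b\<in>B. r b x *\<^sub>R b))"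
proof -
  obtain B0 :: "'a set" where "finite B0" "span B0 = UNIV"
    using finite_dimensional by blast
  then obtain C :: "'a set" where C: "finite C" "span C = UNIV" "pairwise orthogonal C"
    using basis_orthogonal [of B0] by auto
  define r :: "'a \<Rightarrow> 'a \<Rightarrow> real" where "r = (\<lambda>b x. (x \<bullet> b) / (b \<bullet> b))"
  have lin: "bounded_linear (r b)" for b
    unfolding r_def divide_inverse by (intro bounded_linear_intros)
  have "x = (\<Sum>b\<in>C. r b x *\<^sub>R b)" for x
  proof -
    let ?d = "x - (\<Sum>b\<in>C. r b x *\<^sub>R b)"
    have "orthogonal ?d c" if "c \<in> C" for c
    proof -
      have "(\<Sum>b\<in>C. r b x * (b \<bullet> c)) = (\<Sum>b\<in>C. if b = c then r c x * (c \<bullet> c) else 0)"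
        using C(3) that by (intro sum.cong) (auto simp: pairwise_def orthogonal_def)
      also have "\<dots> = x \<bullet> c"
        using C(1) that by (simp add: r_def)
      finally show ?thesis
        by (simp add: orthogonal_def inner_diff_left inner_sum_left)
    qed
    then have "orthogonal ?d ?d"
      using orthogonal_to_span [of ?d C ?d] C(2) by simp
    then show ?thesis by (simp add: orthogonal_def)
  qed
  with C(1) lin show ?thesis by blast
qed

lemma linear_imp_bounded_linear:
  fixes f :: "'a::model_space \<Rightarrow> 'b::real_normed_vector"
  assumes "linear f"
  shows "bounded_linear f"
proof -
  obtain B :: "'a set" and r where B: "finite B" "\<And>b. bounded_linear (r b)"
    "\<And>x. x = (\<Sum>b\<in>B. r b x *\<^sub>R b)"
    using model_space_expansion by metis
  have "f x = (\<Sum>b\<in>B. r b x *\<^sub>R f b)" for x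
    by (subst B(3) [of x]) (simp add: linear_sum [OF assms] linear_scale [OF assms])
  then have eq: "f = (\<lambda>x. \<Sum>b\<in>B. r b x *\<^sub>R f b)" by (rule ext)
  show ?thesis
    by (subst eq) (intro bounded_linear_sum bounded_linear_scaleR_const B)
qed

lemma frechet_derivative_eqI:
  "(f has_derivative f') (at x) \<Longrightarrow> frechet_derivative f (at x) = f'"
  by (rule frechet_derivative_at [symmetric])

lemma frechet_derivative_cong_open:
  assumes "open S" "x \<in> S" "\<And>y. y \<in> S \<Longrightarrow> f y = g y"
  shows "frechet_derivative f (at x) = frechet_derivative g (at x)"
proof -
  have "(f has_derivative D) (at x) \<longleftrightarrow> (g has_derivative D) (at x)" for D
    using has_derivative_transform_within_open [OF _ assms(1,2), of f D UNIV g]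
      has_derivative_transform_within_open [OF _ assms(1,2), of g D UNIV f] assms(3) by auto
  then show ?thesis by (simp add: frechet_derivative_def)
qed

lemma Ck_on_subset: "Ck_on k T f \<Longrightarrow> S \<subseteq> T \<Longrightarrow> Ck_on k S f"
  by (induction k arbitrary: f) (auto intro: continuous_on_subset)

lemma Ck_on_cong:
  assumes "open S" "\<And>x. x \<in> S \<Longrightarrow> f x = g x"
  shows "Ck_on k S f \<longleftrightarrow> Ck_on k S g"
  using assms(2)
proof (induction k arbitrary: f g)
  case 0
  then show ?case by (simp cong: continuous_on_cong)
next
  case (Suc k)
  have "f differentiable (at x) \<longleftrightarrow> g differentiable (at x)" if "x \<in> S" for x
    unfolding differentiable_def
    using has_derivative_transform_within_open [OF _ assms(1) that, of f _ UNIV g]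
      has_derivative_transform_within_open [OF _ assms(1) that, of g _ UNIV f] Suc.prems
    by auto
  moreover have "Ck_on k S (\<lambda>x. frechet_derivative f (at x) v) \<longleftrightarrow>
      Ck_on k S (\<lambda>x. frechet_derivative g (at x) v)" for v
    by (rule Suc.IH) (simp add: frechet_derivative_cong_open [OF assms(1) _ Suc.prems])
  ultimately show ?case by auto
qed

lemma Ck_on_SucD: "Ck_on (Suc k) S f \<Longrightarrow> Ck_on k S f"
proof (induction k arbitrary: f)
  case 0
  then show ?case
    by (auto intro!: continuous_at_imp_continuous_on differentiable_imp_continuous_within)
next
  case (Suc k)
  have "Ck_on k S (\<lambda>x. frechet_derivative f (at x) v)" for v
    using Suc.prems Suc.IH by simp
  with Suc.prems show ?case by simp
qed

text \<open>
  On the open set \<open>S\<close> the derivative may be replaced by any formula \<open>D\<close> for it, since functions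
  that agree on an open set have the same derivatives of all orders there.
\<close>

lemma Ck_on_SucI:
  assumes "open S"
    and D: "\<And>x. x \<in> S \<Longrightarrow> (f has_derivative D x) (at x)"
    and "\<And>v. Ck_on k S (\<lambda>x. D x v)"
  shows "Ck_on (Suc k) S f"
proof -
  have "Ck_on k S (\<lambda>x. frechet_derivative f (at x) v) \<longleftrightarrow> Ck_on k S (\<lambda>x. D x v)" for v
    by (rule Ck_on_cong) (simp_all add: assms frechet_derivative_eqI [OF D])
  with assms show ?thesis by (auto simp: differentiable_def)
qed

lemma Ck_on_Suc_has_derivative:
  "Ck_on (Suc k) S f \<Longrightarrow> x \<in> S \<Longrightarrow> (f has_derivative frechet_derivative f (at x)) (at x)"
  by (simp add: frechet_derivative_works)

lemma Ck_on_Union: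
  assumes "\<And>W. W \<in> \<W> \<Longrightarrow> open W" "\<And>W. W \<in> \<W> \<Longrightarrow> Ck_on k W f"
  shows "Ck_on k (\<Union>\<W>) f"
  using assms(2)
proof (induction k arbitrary: f)
  case 0
  then show ?case using assms(1) continuous_on_open_Union [of \<W> f] by simp
qed auto

lemma Ck_on_const: "open S \<Longrightarrow> Ck_on k S (\<lambda>x. c)"
proof (induction k arbitrary: c)
  case (Suc k)
  show ?case by (rule Ck_on_SucI [where D = "\<lambda>x v. 0"]) (use Suc in auto)
qed simp

lemma Ck_on_add:
  assumes "open S" "Ck_on k S f" "Ck_on k S g"
  shows "Ck_on k S (\<lambda>x. f x + g x)"
  using assms(2,3)
proof (induction k arbitrary: f g)
  case 0
  then show ?case by (simp add: continuous_on_add)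
next
  case (Suc k)
  show ?case
  proof (rule Ck_on_SucI [OF assms(1)])
    show "((\<lambda>x. f x + g x) has_derivative
        (\<lambda>v. frechet_derivative f (at x) v + frechet_derivative g (at x) v)) (at x)"
      if "x \<in> S" for x
      using Suc.prems that by (intro has_derivative_add Ck_on_Suc_has_derivative)
  qed (use Suc in auto)
qed

lemma Ck_on_sum:
  assumes "open S" "\<And>i. i \<in> I \<Longrightarrow> Ck_on k S (f i)"
  shows "Ck_on k S (\<lambda>x. \<Sum>i\<in>I. f i x)"
  using assms(2)
  by (induction I rule: infinite_finite_induct)
    (simp_all add: Ck_on_const Ck_on_add assms(1))

lemma Ck_on_scaleR:
  assumes "open S" "Ck_on k S f" "Ck_on k S g"
  shows "Ck_on k S (\<lambda>x. f x *\<^sub>R g x)"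
  using assms(2,3)
proof (induction k arbitrary: f g)
  case 0
  then show ?case by (simp add: continuous_on_scaleR)
next
  case (Suc k)
  note SucD = Suc.prems [THEN Ck_on_SucD]
  show ?case
  proof (rule Ck_on_SucI [OF assms(1)])
    show "((\<lambda>x. f x *\<^sub>R g x) has_derivative
        (\<lambda>v. f x *\<^sub>R frechet_derivative g (at x) v + frechet_derivative f (at x) v *\<^sub>R g x)) (at x)"
      if "x \<in> S" for x
      using Suc.prems that by (intro has_derivative_scaleR Ck_on_Suc_has_derivative)
  qed (use Suc SucD in \<open>auto intro!: Ck_on_add assms(1)\<close>)
qed

lemma Ck_on_bounded_linear_compose:
  assumes "open S" "bounded_linear l" "Ck_on k S f"
  shows "Ck_on k S (\<lambda>x. l (f x))"
  using assms(3)
proof (induction k arbitrary: f)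
  case 0
  then show ?case by (simp add: bounded_linear.continuous_on assms(2))
next
  case (Suc k)
  show ?case
  proof (rule Ck_on_SucI [OF assms(1)])
    show "((\<lambda>x. l (f x)) has_derivative (\<lambda>v. l (frechet_derivative f (at x) v))) (at x)"
      if "x \<in> S" for x
      by (rule bounded_linear.has_derivative
          [OF assms(2) Ck_on_Suc_has_derivative [OF Suc.prems that]])
  qed (use Suc in auto)
qed

lemma Ck_on_id: "open S \<Longrightarrow> Ck_on k S (\<lambda>x. x)"
proof (cases k)
  case (Suc n)
  assume "open S"
  then show ?thesis unfolding Suc
    by (intro Ck_on_SucI [where D = "\<lambda>x v. v"] Ck_on_const) auto
qed auto

lemma Ck_on_Pair:
  assumes "open S" "Ck_on k S f" "Ck_on k S g"
  shows "Ck_on k S (\<lambda>x. (f x, g x))"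
  using assms(2,3)
proof (induction k arbitrary: f g)
  case 0
  then show ?case by (simp add: continuous_on_Pair)
next
  case (Suc k)
  show ?case
  proof (rule Ck_on_SucI [OF assms(1)])
    show "((\<lambda>x. (f x, g x)) has_derivative
        (\<lambda>v. (frechet_derivative f (at x) v, frechet_derivative g (at x) v))) (at x)"
      if "x \<in> S" for x
      using Suc.prems that by (intro has_derivative_Pair Ck_on_Suc_has_derivative)
  qed (use Suc in auto)
qed

text \<open>
  The chain rule gives \<open>D g (f x) (D f x v)\<close>, where the direction in which \<open>g\<close> is differentiated
  depends on \<open>x\<close>, whereas the induction hypothesis concerns fixed directions. Expanding
  \<open>D f x v\<close> in a spanning set reduces the derivative to a sum of products of a coordinate of
  \<open>D f x v\<close> and a derivative of \<open>g\<close> in a fixed direction.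
\<close>

lemma Ck_on_compose:
  fixes g :: "'b::model_space \<Rightarrow> 'c::real_normed_vector"
  assumes "open S" "Ck_on k S f" "Ck_on k T g" "f ` S \<subseteq> T"
  shows "Ck_on k S (\<lambda>x. g (f x))"
  using assms(2,3)
proof (induction k arbitrary: g)
  case 0
  then show ?case using continuous_on_compose2 assms(4) by auto
next
  case (Suc k)
  obtain B :: "'b set" and r where B: "finite B" "\<And>b. bounded_linear (r b)"
    "\<And>x. x = (\<Sum>b\<in>B. r b x *\<^sub>R b)"
    using model_space_expansion by metis
  let ?Df = "\<lambda>x. frechet_derivative f (at x)" and ?Dg = "\<lambda>y. frechet_derivative g (at y)"
  have Dg: "(g has_derivative ?Dg (f x)) (at (f x))" if "x \<in> S" for x
    using Suc.prems(2) that assms(4) Ck_on_Suc_has_derivative by blast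
  show ?case
  proof (rule Ck_on_SucI [OF assms(1)])
    fix x assume x: "x \<in> S"
    have lin: "linear (?Dg (f x))" using Dg [OF x] by (rule has_derivative_linear)
    have D: "((\<lambda>x. g (f x)) has_derivative (\<lambda>v. ?Dg (f x) (?Df x v))) (at x)"
      using Suc.prems(1) x by (intro has_derivative_compose [where f = f and g = g, OF _ Dg [OF x]]
          Ck_on_Suc_has_derivative)
    have "?Dg (f x) w = (\<Sum>b\<in>B. r b w *\<^sub>R ?Dg (f x) b)" for w
      by (subst B(3) [of w]) (simp add: linear_sum [OF lin] linear_scale [OF lin])
    then show "((\<lambda>x. g (f x)) has_derivative
        (\<lambda>v. \<Sum>b\<in>B. r b (?Df x v) *\<^sub>R ?Dg (f x) b)) (at x)"
      by (intro has_derivative_eq_rhs [OF D] ext)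
  next
    fix v
    have "Ck_on k S (\<lambda>x. r b (?Df x v))" for b
      using Suc.prems(1) by (auto intro: Ck_on_bounded_linear_compose [OF assms(1) B(2)])
    moreover have "Ck_on k S (\<lambda>x. ?Dg (f x) b)" for b
      using Suc.prems(2) by (intro Suc.IH Ck_on_SucD [OF Suc.prems(1)]) simp
    ultimately show "Ck_on k S (\<lambda>x. \<Sum>b\<in>B. r b (?Df x v) *\<^sub>R ?Dg (f x) b)"
      by (intro Ck_on_sum Ck_on_scaleR assms(1))
  qed
qed

lemma smooth_on_subset: "smooth_on T f \<Longrightarrow> S \<subseteq> T \<Longrightarrow> smooth_on S f"
  by (auto simp: smooth_on_def intro: Ck_on_subset)

lemma smooth_on_cong:
  assumes "open S" "smooth_on S g" "\<And>x. x \<in> S \<Longrightarrow> f x = g x"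
  shows "smooth_on S f"
  using assms Ck_on_cong [of S f g] by (auto simp: smooth_on_def)

lemma smooth_on_imp_continuous_on: "smooth_on S f \<Longrightarrow> continuous_on S f"
  unfolding smooth_on_def by (metis Ck_on.simps(1))

lemma smooth_on_has_derivative:
  "smooth_on S f \<Longrightarrow> x \<in> S \<Longrightarrow> (f has_derivative frechet_derivative f (at x)) (at x)"
  unfolding smooth_on_def using Ck_on_Suc_has_derivative by blast

lemma smooth_on_local:
  assumes "\<And>x. x \<in> S \<Longrightarrow> \<exists>W. open W \<and> x \<in> W \<and> smooth_on W f"
  shows "smooth_on S f"
proof -
  let ?\<W> = "{W. open W \<and> smooth_on W f}"
  have "smooth_on (\<Union>?\<W>) f"
    unfolding smooth_on_def by (intro allI Ck_on_Union) (auto simp: smooth_on_def)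
  with assms show ?thesis by (blast intro: smooth_on_subset)
qed

lemma smooth_on_const: "open S \<Longrightarrow> smooth_on S (\<lambda>x. c)"
  by (simp add: smooth_on_def Ck_on_const)

lemma smooth_on_id: "open S \<Longrightarrow> smooth_on S (\<lambda>x. x)"
  by (simp add: smooth_on_def Ck_on_id)

lemma smooth_on_bounded_linear: "open S \<Longrightarrow> bounded_linear l \<Longrightarrow> smooth_on S l"
  using Ck_on_bounded_linear_compose [OF _ _ Ck_on_id] by (auto simp: smooth_on_def)

lemma smooth_on_Pair:
  "open S \<Longrightarrow> smooth_on S f \<Longrightarrow> smooth_on S g \<Longrightarrow> smooth_on S (\<lambda>x. (f x, g x))"
  by (simp add: smooth_on_def Ck_on_Pair)

lemma smooth_on_compose:
  fixes g :: "'b::model_space \<Rightarrow> 'c::real_normed_vector"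
  shows "open S \<Longrightarrow> smooth_on S f \<Longrightarrow> smooth_on T g \<Longrightarrow> f ` S \<subseteq> T \<Longrightarrow> smooth_on S (\<lambda>x. g (f x))"
  unfolding smooth_on_def using Ck_on_compose by blast

section \<open>Pointwise smoothness of maps between manifolds\<close>

lemma chart_inv_coord: "chart c \<Longrightarrow> x \<in> fst c \<Longrightarrow> chart_inv c (snd c x) = x"
  by (simp add: chart_def chart_inv_def)

lemma coord_chart_inv: "y \<in> snd c ` fst c \<Longrightarrow> snd c (chart_inv c y) = y"
  by (simp add: chart_inv_def f_inv_into_f)

lemma chart_inv_in: "y \<in> snd c ` fst c \<Longrightarrow> chart_inv c y \<in> fst c"
  by (simp add: chart_inv_def inv_into_into)

lemma chart_coord_mem_image:
  "chart c \<Longrightarrow> x \<in> fst c \<Longrightarrow> snd c x \<in> snd c ` S \<Longrightarrow> S \<subseteq> fst c \<Longrightarrow> x \<in> S"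
  by (auto simp: chart_def inj_on_def)

text \<open>
  Smoothness near \<open>p\<close> read in one chart on each side. Continuity is built in: the coordinate
  neighbourhood \<open>W\<close> is required to be mapped into the domain of \<open>d\<close>.
\<close>

definition smooth_at_charts ::
  "('a, 'e::model_space) chart \<Rightarrow> ('b, 'f::model_space) chart \<Rightarrow> ('a \<Rightarrow> 'b) \<Rightarrow> 'a \<Rightarrow> bool" where
  "smooth_at_charts c d f p \<longleftrightarrow> p \<in> fst c \<and>
     (\<exists>W. open W \<and> snd c p \<in> W \<and> W \<subseteq> snd c ` fst c \<and>
        (\<forall>y\<in>W. f (chart_inv c y) \<in> fst d) \<and> smooth_on W (snd d \<circ> f \<circ> chart_inv c))"

definition smooth_at ::
  "('a, 'e::model_space) atlas \<Rightarrow> ('b, 'f::model_space) atlas \<Rightarrow> ('a \<Rightarrow> 'b) \<Rightarrow> 'a \<Rightarrow> bool" where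
  "smooth_at A B f p \<longleftrightarrow> (\<exists>c\<in>A. \<exists>d\<in>B. smooth_at_charts c d f p)"

lemma smooth_at_chartsI:
  assumes "p \<in> fst c" "open W" "snd c p \<in> W" "W \<subseteq> snd c ` fst c"
    "\<And>y. y \<in> W \<Longrightarrow> f (chart_inv c y) \<in> fst d" "smooth_on W (\<lambda>y. snd d (f (chart_inv c y)))"
  shows "smooth_at_charts c d f p"
  using assms unfolding smooth_at_charts_def comp_def by blast

lemma smooth_at_chartsE:
  assumes "smooth_at_charts c d f p"
  obtains W where "p \<in> fst c" "open W" "snd c p \<in> W" "W \<subseteq> snd c ` fst c"
    "\<And>y. y \<in> W \<Longrightarrow> f (chart_inv c y) \<in> fst d" "smooth_on W (\<lambda>y. snd d (f (chart_inv c y)))"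
  using assms unfolding smooth_at_charts_def comp_def by blast

lemma smooth_at_charts_maps: "chart c \<Longrightarrow> smooth_at_charts c d f p \<Longrightarrow> f p \<in> fst d"
  by (erule smooth_at_chartsE) (metis chart_inv_coord)

lemma smooth_at_charts_id: "chart c \<Longrightarrow> p \<in> fst c \<Longrightarrow> smooth_at_charts c c (\<lambda>x. x) p"
  by (rule smooth_at_chartsI [where W = "snd c ` fst c"])
    (auto simp: chart_inv_in chart_def intro!: smooth_on_cong [OF _ smooth_on_id] coord_chart_inv)

lemma smooth_at_charts_compose:
  assumes d: "chart d" and c: "chart c"
    and f: "smooth_at_charts c d f p" and g: "smooth_at_charts d e g (f p)"
  shows "smooth_at_charts c e (\<lambda>x. g (f x)) p"
proof -
  obtain V where V: "p \<in> fst c" "open V" "snd c p \<in> V" "V \<subseteq> snd c ` fst c"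
    "\<And>y. y \<in> V \<Longrightarrow> f (chart_inv c y) \<in> fst d" and Vs: "smooth_on V (\<lambda>y. snd d (f (chart_inv c y)))"
    by (rule smooth_at_chartsE [OF f]) blast
  obtain W where W: "open W" "snd d (f p) \<in> W" "W \<subseteq> snd d ` fst d"
    "\<And>y. y \<in> W \<Longrightarrow> g (chart_inv d y) \<in> fst e" and Ws: "smooth_on W (\<lambda>y. snd e (g (chart_inv d y)))"
    by (rule smooth_at_chartsE [OF g]) blast
  let ?F = "\<lambda>y. snd d (f (chart_inv c y))"
  let ?X = "V \<inter> ?F -` W"
  have op: "open ?X"
    using continuous_open_preimage [OF smooth_on_imp_continuous_on [OF Vs]] V W by blast
  have eq: "chart_inv d (?F y) = f (chart_inv c y)" if "y \<in> V" for y
    using V(5) [OF that] d by (simp add: chart_inv_coord)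
  show ?thesis
  proof (rule smooth_at_chartsI [OF V(1) op])
    show "snd c p \<in> ?X" using V W c by (simp add: chart_inv_coord)
    show "?X \<subseteq> snd c ` fst c" using V by blast
    show "g (f (chart_inv c y)) \<in> fst e" if "y \<in> ?X" for y
      using W(4) [of "?F y"] eq [of y] that by simp
    have "smooth_on ?X (\<lambda>y. snd e (g (chart_inv d (?F y))))"
      using smooth_on_compose [OF op smooth_on_subset [OF Vs] Ws] by auto
    then show "smooth_on ?X (\<lambda>y. snd e (g (f (chart_inv c y))))"
      by (rule smooth_on_cong [OF op]) (simp add: eq)
  qed
qed

lemma smooth_at_charts_cong:
  assumes "chart c" "smooth_at_charts c d f p" "open (snd c ` (fst c \<inter> S))" "p \<in> S"
    "\<And>x. x \<in> S \<Longrightarrow> f x = g x"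
  shows "smooth_at_charts c d g p"
proof -
  obtain V where V: "p \<in> fst c" "open V" "snd c p \<in> V" "V \<subseteq> snd c ` fst c"
    "\<And>y. y \<in> V \<Longrightarrow> f (chart_inv c y) \<in> fst d" and Vs: "smooth_on V (\<lambda>y. snd d (f (chart_inv c y)))"
    by (rule smooth_at_chartsE [OF assms(2)]) blast
  let ?X = "V \<inter> snd c ` (fst c \<inter> S)"
  have op: "open ?X" using V assms(3) by blast
  have eq: "f (chart_inv c y) = g (chart_inv c y)" if "y \<in> ?X" for y
    using that assms(1,5) by (auto simp: chart_inv_coord)
  show ?thesis
  proof (rule smooth_at_chartsI [OF V(1) op])
    show "snd c p \<in> ?X" using V assms by blast
    show "?X \<subseteq> snd c ` fst c" by blast
    show "g (chart_inv c y) \<in> fst d" if "y \<in> ?X" for y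
      using eq [OF that] V(5) [of y] that by simp
    show "smooth_on ?X (\<lambda>y. snd d (g (chart_inv c y)))"
      by (rule smooth_on_cong [OF op smooth_on_subset [OF Vs]]) (auto simp: eq)
  qed
qed

lemma smooth_at_charts_Pair:
  assumes c: "chart c" and f: "smooth_at_charts c d f p" and g: "smooth_at_charts c e g p"
  shows "smooth_at_charts c (fst d \<times> fst e, map_prod (snd d) (snd e)) (\<lambda>x. (f x, g x)) p"
proof -
  obtain V where V: "p \<in> fst c" "open V" "snd c p \<in> V" "V \<subseteq> snd c ` fst c"
    "\<And>y. y \<in> V \<Longrightarrow> f (chart_inv c y) \<in> fst d" "smooth_on V (\<lambda>y. snd d (f (chart_inv c y)))"
    by (rule smooth_at_chartsE [OF f]) blast
  obtain W where W: "open W" "snd c p \<in> W" "W \<subseteq> snd c ` fst c"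
    "\<And>y. y \<in> W \<Longrightarrow> g (chart_inv c y) \<in> fst e" "smooth_on W (\<lambda>y. snd e (g (chart_inv c y)))"
    by (rule smooth_at_chartsE [OF g]) blast
  have op: "open (V \<inter> W)" using V W by blast
  show ?thesis
    by (rule smooth_at_chartsI [OF V(1) op])
      (use V W in \<open>auto intro!: smooth_on_Pair op intro: smooth_on_subset\<close>)
qed

lemma compatible_imp_smooth_at_charts:
  assumes "chart c" "compatible c c'" "p \<in> fst c" "p \<in> fst c'"
  shows "smooth_at_charts c c' (\<lambda>x. x) p"
  by (rule smooth_at_chartsI [where W = "snd c ` (fst c \<inter> fst c')"])
    (use assms in \<open>auto simp: compatible_def transition_def chart_inv_coord comp_def\<close>)

lemma compatible_sym: "compatible c c' \<Longrightarrow> compatible c' c"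
  by (auto simp: compatible_def Int_commute)

lemma smooth_at_charts_imp_smooth_transition:
  assumes c: "chart c"
    and sm: "\<And>x. x \<in> fst c \<Longrightarrow> x \<in> fst c' \<Longrightarrow> smooth_at_charts c c' (\<lambda>x. x) x"
  shows "open (snd c ` (fst c \<inter> fst c')) \<and> smooth_on (snd c ` (fst c \<inter> fst c')) (transition c c')"
proof -
  have loc: "\<exists>W. open W \<and> y \<in> W \<and> W \<subseteq> snd c ` (fst c \<inter> fst c') \<and> smooth_on W (transition c c')"
    if "y \<in> snd c ` (fst c \<inter> fst c')" for y
  proof -
    from that obtain x where x: "x \<in> fst c" "x \<in> fst c'" "y = snd c x" by blast
    obtain W where W: "open W" "snd c x \<in> W" "W \<subseteq> snd c ` fst c"
      "\<And>y. y \<in> W \<Longrightarrow> chart_inv c y \<in> fst c'" "smooth_on W (\<lambda>y. snd c' (chart_inv c y))"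
      by (rule smooth_at_chartsE [OF sm [OF x(1,2)]]) blast
    have "W \<subseteq> snd c ` (fst c \<inter> fst c')"
    proof
      fix w assume w: "w \<in> W"
      then have "w \<in> snd c ` fst c" using W by blast
      then have "w = snd c (chart_inv c w)" "chart_inv c w \<in> fst c"
        by (simp_all add: coord_chart_inv chart_inv_in)
      with W(4) [OF w] show "w \<in> snd c ` (fst c \<inter> fst c')" by blast
    qed
    with W x show ?thesis by (auto simp: transition_def comp_def)
  qed
  then have "open (snd c ` (fst c \<inter> fst c'))" by (subst open_subopen) blast
  moreover have "smooth_on (snd c ` (fst c \<inter> fst c')) (transition c c')"
    using loc by (intro smooth_on_local) blast
  ultimately show ?thesis ..
qed

text \<open>
  Compatibility of charts is smoothness of the identity in both directions. Closure properties of
  compatibility thereby reduce to composition and pairing of smooth maps.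
\<close>

lemma compatible_iff_smooth_at_charts:
  assumes "chart c" "chart c'"
  shows "compatible c c' \<longleftrightarrow> (\<forall>x\<in>fst c \<inter> fst c'.
    smooth_at_charts c c' (\<lambda>x. x) x \<and> smooth_at_charts c' c (\<lambda>x. x) x)"
proof
  assume "compatible c c'"
  then show "\<forall>x\<in>fst c \<inter> fst c'. smooth_at_charts c c' (\<lambda>x. x) x \<and> smooth_at_charts c' c (\<lambda>x. x) x"
    using compatible_imp_smooth_at_charts [OF assms(1)]
      compatible_imp_smooth_at_charts [OF assms(2) compatible_sym] by simp
next
  assume *: "\<forall>x\<in>fst c \<inter> fst c'. smooth_at_charts c c' (\<lambda>x. x) x \<and> smooth_at_charts c' c (\<lambda>x. x) x"
  show "compatible c c'"
    using smooth_at_charts_imp_smooth_transition [OF assms(1), of c']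
      smooth_at_charts_imp_smooth_transition [OF assms(2), of c] *
    unfolding compatible_def by (simp add: Int_commute)
qed

lemma atlas_chart: "atlas A \<Longrightarrow> c \<in> A \<Longrightarrow> chart c"
  by (simp add: atlas_def)

lemma atlas_compatible: "atlas A \<Longrightarrow> c \<in> A \<Longrightarrow> c' \<in> A \<Longrightarrow> compatible c c'"
  by (simp add: atlas_def)

lemma mcarrier_chartE:
  assumes "p \<in> mcarrier A" obtains c where "c \<in> A" "p \<in> fst c"
  using assms by (auto simp: mcarrier_def)

lemma smooth_at_charts_change_source:
  assumes "atlas A" "c \<in> A" "c' \<in> A" "p \<in> fst c'" "smooth_at_charts c d f p"
  shows "smooth_at_charts c' d f p"
proof -
  have "p \<in> fst c" using assms by (auto simp: smooth_at_charts_def)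
  then have "smooth_at_charts c' c (\<lambda>x. x) p"
    using assms by (intro compatible_imp_smooth_at_charts) (auto simp: atlas_chart atlas_compatible)
  from smooth_at_charts_compose [OF atlas_chart [OF assms(1,2)] atlas_chart [OF assms(1,3)] this assms(5)]
  show ?thesis .
qed

lemma smooth_at_charts_change_target:
  assumes "atlas B" "d \<in> B" "d' \<in> B" "chart c" "f p \<in> fst d'" "smooth_at_charts c d f p"
  shows "smooth_at_charts c d' f p"
proof -
  have "f p \<in> fst d" by (rule smooth_at_charts_maps [OF assms(4,6)])
  then have "smooth_at_charts d d' (\<lambda>x. x) (f p)"
    using assms by (intro compatible_imp_smooth_at_charts) (auto simp: atlas_chart atlas_compatible)
  from smooth_at_charts_compose [OF atlas_chart [OF assms(1,2)] assms(4,6) this] show ?thesis .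
qed

text \<open>
  Independence of the charts: a change of chart is composition with a smooth identity map.
\<close>

lemma smooth_atD:
  assumes "atlas A" "atlas B" "smooth_at A B f p" "c \<in> A" "p \<in> fst c" "d \<in> B" "f p \<in> fst d"
  shows "smooth_at_charts c d f p"
proof -
  obtain c0 d0 where "c0 \<in> A" "d0 \<in> B" "smooth_at_charts c0 d0 f p"
    using assms(3) by (auto simp: smooth_at_def)
  then show ?thesis
    using assms atlas_chart smooth_at_charts_change_source smooth_at_charts_change_target by metis
qed

lemma smooth_atI: "c \<in> A \<Longrightarrow> d \<in> B \<Longrightarrow> smooth_at_charts c d f p \<Longrightarrow> smooth_at A B f p"
  by (auto simp: smooth_at_def)

lemma smooth_atE:
  assumes "smooth_at A B f p" "atlas A"
  obtains c d where "c \<in> A" "d \<in> B" "chart c" "p \<in> fst c" "f p \<in> fst d" "smooth_at_charts c d f p"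
proof -
  obtain c d where "c \<in> A" "d \<in> B" "smooth_at_charts c d f p"
    using assms(1) unfolding smooth_at_def by blast
  moreover from this assms(2) have "chart c" by (simp add: atlas_chart)
  ultimately show thesis
    using that smooth_at_charts_maps [of c d f p] by (simp add: smooth_at_charts_def)
qed

lemma smooth_at_maps: "atlas A \<Longrightarrow> smooth_at A B f p \<Longrightarrow> f p \<in> mcarrier B"
  by (erule smooth_atE) (auto simp: mcarrier_def intro: bexI)

lemma smooth_at_compose:
  assumes at: "atlas A" "atlas B" "atlas C" and f: "smooth_at A B f p" and g: "smooth_at B C g (f p)"
  shows "smooth_at A C (\<lambda>x. g (f x)) p"
proof -
  obtain c d where cd: "c \<in> A" "d \<in> B" "chart c" "p \<in> fst c" "f p \<in> fst d" "smooth_at_charts c d f p"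
    by (rule smooth_atE [OF f at(1)]) blast
  obtain d' e where de: "d' \<in> B" "e \<in> C" "smooth_at_charts d' e g (f p)"
    by (rule smooth_atE [OF g at(2)]) blast
  have "smooth_at_charts d e g (f p)"
    by (rule smooth_at_charts_change_source [OF at(2) de(1) cd(2,5) de(3)])
  then have "smooth_at_charts c e (\<lambda>x. g (f x)) p"
    by (rule smooth_at_charts_compose [OF atlas_chart [OF at(2) cd(2)] cd(3,6)])
  then show ?thesis by (rule smooth_atI [OF cd(1) de(2)])
qed

lemma topspace_mtopology: "atlas A \<Longrightarrow> topspace (mtopology A) = mcarrier A"
proof -
  assume A: "atlas A"
  have "snd c ` (mcarrier A \<inter> fst c) = snd c ` fst c" if "c \<in> A" for c
    using that by (auto simp: mcarrier_def)
  then have "openin (mtopology A) (mcarrier A)"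
    using A by (auto simp: openin_mtopology atlas_def chart_def)
  then show ?thesis
    using openin_mtopology [OF A] by (metis openin_subset openin_topspace subset_antisym)
qed

lemma openin_mtopology_coord:
  "atlas A \<Longrightarrow> openin (mtopology A) S \<Longrightarrow> c \<in> A \<Longrightarrow> open (snd c ` (fst c \<inter> S))"
  by (simp add: openin_mtopology Int_commute)

lemma openin_chart_domain: "atlas A \<Longrightarrow> c \<in> A \<Longrightarrow> openin (mtopology A) (fst c)"
  by (auto simp: openin_mtopology mcarrier_def atlas_def compatible_def)

lemma smooth_at_cong:
  assumes "atlas A" "smooth_at A B f p" "openin (mtopology A) S" "p \<in> S" "\<And>x. x \<in> S \<Longrightarrow> f x = g x"
  shows "smooth_at A B g p"
proof -
  obtain c d where cd: "c \<in> A" "d \<in> B" "chart c" "smooth_at_charts c d f p"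
    by (rule smooth_atE [OF assms(2,1)]) blast
  have "smooth_at_charts c d g p"
    by (rule smooth_at_charts_cong [OF cd(3,4) openin_mtopology_coord [OF assms(1,3) cd(1)] assms(4,5)])
  then show ?thesis by (rule smooth_atI [OF cd(1,2)])
qed

text \<open>
  Smoothness of a map is a local condition at each point; continuity comes for free because a map
  that is smooth in coordinates is continuous in coordinates. Every structure map of the groupoid
  is shown to be smooth through this equivalence, one trivialization at a time.
\<close>

lemma smooth_map_iff_smooth_at:
  assumes A: "atlas A" and B: "atlas B"
  shows "smooth_map A B f \<longleftrightarrow> (\<forall>p\<in>mcarrier A. smooth_at A B f p)"
proof
  assume f: "smooth_map A B f"
  show "\<forall>p\<in>mcarrier A. smooth_at A B f p"
  proof
    fix p assume p: "p \<in> mcarrier A"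
    then obtain c where c: "c \<in> A" "p \<in> fst c" by (rule mcarrier_chartE)
    have cont: "continuous_map (mtopology A) (mtopology B) f"
      using f by (simp add: smooth_map_def)
    then have "f p \<in> mcarrier B"
      using p A B by (auto simp: continuous_map_def topspace_mtopology)
    then obtain d where d: "d \<in> B" "f p \<in> fst d" by (rule mcarrier_chartE)
    have "openin (mtopology A) {x \<in> mcarrier A. f x \<in> fst d}"
      using openin_continuous_map_preimage [OF cont openin_chart_domain [OF B d(1)]] A
      by (simp add: topspace_mtopology)
    then have "open (snd c ` (fst c \<inter> {x \<in> mcarrier A. f x \<in> fst d}))"
      by (rule openin_mtopology_coord [OF A _ c(1)])
    moreover have "fst c \<inter> {x \<in> mcarrier A. f x \<in> fst d} = fst c \<inter> f -` fst d"
      using c(1) by (auto simp: mcarrier_def)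
    ultimately have "smooth_at_charts c d f p"
      using f c d A by (intro smooth_at_chartsI [where W = "snd c ` (fst c \<inter> f -` fst d)"])
        (auto simp: smooth_map_def comp_def chart_inv_coord atlas_chart)
    with c d show "smooth_at A B f p" by (auto intro: smooth_atI)
  qed
next
  assume f: "\<forall>p\<in>mcarrier A. smooth_at A B f p"
  have loc: "\<exists>W. open W \<and> snd c p \<in> W \<and> W \<subseteq> snd c ` fst c \<and>
      (\<forall>y\<in>W. f (chart_inv c y) \<in> fst d) \<and> smooth_on W (\<lambda>y. snd d (f (chart_inv c y)))"
    if "c \<in> A" "d \<in> B" "p \<in> fst c" "f p \<in> fst d" for c d p
  proof -
    have "p \<in> mcarrier A" using that by (auto simp: mcarrier_def)
    then have "smooth_at_charts c d f p"
      using f that smooth_atD [OF A B] by blast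
    then show ?thesis unfolding smooth_at_charts_def comp_def by blast
  qed
  have "continuous_map (mtopology A) (mtopology B) f"
    unfolding continuous_map_def
  proof (intro conjI allI impI)
    show "f \<in> topspace (mtopology A) \<rightarrow> topspace (mtopology B)"
      using f smooth_at_maps [OF A, of B f] by (simp add: topspace_mtopology A B Pi_def)
    fix T assume T: "openin (mtopology B) T"
    let ?P = "{x \<in> mcarrier A. f x \<in> T}"
    have "open (snd c ` (?P \<inter> fst c))" if c: "c \<in> A" for c
    proof (subst open_subopen, intro ballI)
      fix y assume "y \<in> snd c ` (?P \<inter> fst c)"
      then obtain p where p: "p \<in> mcarrier A" "f p \<in> T" "p \<in> fst c" "y = snd c p" by blast
      have "T \<subseteq> mcarrier B" using T by (simp add: openin_mtopology B)
      then have "f p \<in> mcarrier B" using p(2) by blast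
      then obtain d where d: "d \<in> B" "f p \<in> fst d" by (rule mcarrier_chartE)
      obtain W where W: "open W" "snd c p \<in> W" "W \<subseteq> snd c ` fst c"
        "\<forall>y\<in>W. f (chart_inv c y) \<in> fst d" "smooth_on W (\<lambda>y. snd d (f (chart_inv c y)))"
        using loc [OF c d(1) p(3) d(2)] by blast
      let ?F = "\<lambda>y. snd d (f (chart_inv c y))"
      let ?X = "W \<inter> ?F -` (snd d ` (fst d \<inter> T))"
      \<comment> \<open>\<open>?X\<close> is the coordinate image of the part of \<open>W\<close> that \<open>f\<close> maps into \<open>T\<close>.\<close>
      have "open ?X"
        by (rule continuous_open_preimage [OF smooth_on_imp_continuous_on [OF W(5)] W(1)
              openin_mtopology_coord [OF B T d(1)]])
      moreover have "y \<in> ?X"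
        using W p d c A by (auto simp: chart_inv_coord atlas_chart)
      moreover have "?X \<subseteq> snd c ` (?P \<inter> fst c)"
      proof
        fix w assume w: "w \<in> ?X"
        then have im: "w \<in> snd c ` fst c" using W by blast
        have "f (chart_inv c w) \<in> fst d" using w W by blast
        with w have "f (chart_inv c w) \<in> T"
          using chart_coord_mem_image [OF atlas_chart [OF B d(1)], of "f (chart_inv c w)" "fst d \<inter> T"]
          by blast
        moreover have "chart_inv c w \<in> fst c" "w = snd c (chart_inv c w)"
          using im by (simp_all add: chart_inv_in coord_chart_inv)
        ultimately show "w \<in> snd c ` (?P \<inter> fst c)"
          using c by (auto simp: mcarrier_def)
      qed
      ultimately show "\<exists>X. open X \<and> y \<in> X \<and> X \<subseteq> snd c ` (?P \<inter> fst c)" by blast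
    qed
    then show "openin (mtopology A) {x \<in> topspace (mtopology A). f x \<in> T}"
      by (auto simp: openin_mtopology topspace_mtopology A)
  qed
  moreover have "smooth_on (snd c ` (fst c \<inter> f -` fst d)) (snd d \<circ> f \<circ> chart_inv c)"
    if "c \<in> A" "d \<in> B" for c d
    unfolding comp_def
  proof (rule smooth_on_local)
    fix y assume "y \<in> snd c ` (fst c \<inter> f -` fst d)"
    then obtain p where "p \<in> fst c" "f p \<in> fst d" "y = snd c p" by blast
    with loc [OF that this(1,2)]
    show "\<exists>W. open W \<and> y \<in> W \<and> smooth_on W (\<lambda>x. snd d (f (chart_inv c x)))" by blast
  qed
  ultimately show "smooth_map A B f" by (simp add: smooth_map_def)
qed

section \<open>Maximal atlases, open submanifolds and products\<close>

lemma atlas_subset_max_atlas: "atlas A \<Longrightarrow> A \<subseteq> max_atlas A"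
  by (auto simp: max_atlas_def atlas_def mcarrier_def)

lemma mcarrier_max_atlas: "atlas A \<Longrightarrow> mcarrier (max_atlas A) = mcarrier A"
  using atlas_subset_max_atlas by (fastforce simp: max_atlas_def mcarrier_def)

lemma atlas_max_atlas:
  assumes A: "atlas A"
  shows "atlas (max_atlas A)"
proof -
  have "smooth_at_charts c c' (\<lambda>x. x) p"
    if "c \<in> max_atlas A" "c' \<in> max_atlas A" "p \<in> fst c" "p \<in> fst c'" for c c' p
  proof -
    have "p \<in> mcarrier A" using that by (auto simp: max_atlas_def)
    then obtain d where d: "d \<in> A" "p \<in> fst d" by (rule mcarrier_chartE)
    have *: "chart c" "chart d" "compatible c d" "compatible d c'"
      using that d A by (auto simp: max_atlas_def atlas_chart compatible_sym)
    show ?thesis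
      using smooth_at_charts_compose [OF *(2,1)
          compatible_imp_smooth_at_charts [OF *(1,3) that(3) d(2)]
          compatible_imp_smooth_at_charts [OF *(2,4) d(2) that(4)]] .
  qed
  moreover have "chart c" if "c \<in> max_atlas A" for c using that by (simp add: max_atlas_def)
  ultimately show ?thesis
    unfolding atlas_def by (simp add: compatible_iff_smooth_at_charts)
qed

lemma atlas_subset: "atlas A \<Longrightarrow> A' \<subseteq> A \<Longrightarrow> atlas A'"
  unfolding atlas_def by blast

text \<open>
  All atlases made of charts of one maximal atlas define the same smooth structure where they are
  defined. Besides the given atlas this covers open submanifolds and the maximal atlas, to which
  slice charts belong.
\<close>

lemma smooth_at_id_max_atlas:
  assumes A: "atlas A" and "B \<subseteq> max_atlas A" "C \<subseteq> max_atlas A" "p \<in> mcarrier B" "p \<in> mcarrier C"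
  shows "smooth_at B C (\<lambda>x. x) p"
proof -
  obtain b where b: "b \<in> B" "p \<in> fst b" using assms(4) by (rule mcarrier_chartE)
  obtain c where c: "c \<in> C" "p \<in> fst c" using assms(5) by (rule mcarrier_chartE)
  have "b \<in> max_atlas A" "c \<in> max_atlas A" using assms b c by auto
  then have "smooth_at_charts b c (\<lambda>x. x) p"
    using atlas_max_atlas [OF A] b c
    by (intro compatible_imp_smooth_at_charts) (auto simp: atlas_chart atlas_compatible)
  with b c show ?thesis by (auto intro: smooth_atI)
qed

lemma smooth_at_id: "atlas A \<Longrightarrow> p \<in> mcarrier A \<Longrightarrow> smooth_at A A (\<lambda>x. x) p"
  by (rule smooth_at_id_max_atlas [of A]) (simp_all add: atlas_subset_max_atlas)

text \<open>
  Shrinking a chart to an open set gives a chart of the same maximal atlas; hence passing to an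
  open submanifold does not affect smoothness at its points.
\<close>

lemma restrict_atlas_subset_max_atlas:
  assumes A: "atlas A" and S: "openin (mtopology A) S"
  shows "restrict_atlas A S \<subseteq> max_atlas A"
proof
  fix c assume "c \<in> restrict_atlas A S"
  then obtain d where d: "d \<in> A" "c = (fst d \<inter> S, snd d)" by (auto simp: restrict_atlas_def)
  have cd: "chart d" using A d by (simp add: atlas_chart)
  have op: "open (snd d ` (fst d \<inter> S))" using openin_mtopology_coord [OF A S d(1)] .
  have c: "chart c" using cd op by (auto simp: d chart_def intro: inj_on_subset)
  have inv: "chart_inv c y = chart_inv d y" if "y \<in> snd d ` (fst d \<inter> S)" for y
    using that c cd by (auto simp: d(2) chart_inv_coord) (metis IntI chart_inv_coord fst_conv snd_conv)
  have "smooth_at_charts c d (\<lambda>x. x) p" if "p \<in> fst c" for p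
    by (rule smooth_at_chartsI [where W = "snd d ` (fst d \<inter> S)"])
      (use that op cd in \<open>auto simp: d(2) inv [unfolded d(2)] chart_inv_coord
          intro!: smooth_on_cong [OF op smooth_on_id [OF op]]\<close>)
  moreover have "smooth_at_charts d c (\<lambda>x. x) p" if "p \<in> fst c" for p
    by (rule smooth_at_chartsI [where W = "snd d ` (fst d \<inter> S)"])
      (use that op cd in \<open>auto simp: d(2) chart_inv_coord
          intro!: smooth_on_cong [OF op smooth_on_id [OF op]]\<close>)
  moreover have sub: "fst c \<subseteq> fst d" by (simp add: d(2))
  ultimately have cd': "smooth_at_charts c d (\<lambda>x. x) p" "smooth_at_charts d c (\<lambda>x. x) p"
    if "p \<in> fst c" for p using that by blast+
  have "compatible c e" if e: "e \<in> A" for e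
  proof -
    have ce: "chart e" using A e by (rule atlas_chart)
    have "smooth_at_charts c e (\<lambda>x. x) p" "smooth_at_charts e c (\<lambda>x. x) p"
      if p: "p \<in> fst c" "p \<in> fst e" for p
    proof -
      have pd: "p \<in> fst d" using p sub by blast
      have "smooth_at_charts d e (\<lambda>x. x) p" "smooth_at_charts e d (\<lambda>x. x) p"
        using compatible_imp_smooth_at_charts [OF cd atlas_compatible [OF A d(1) e] pd p(2)]
          compatible_imp_smooth_at_charts [OF ce atlas_compatible [OF A e d(1)] p(2) pd] .
      then show "smooth_at_charts c e (\<lambda>x. x) p" "smooth_at_charts e c (\<lambda>x. x) p"
        using smooth_at_charts_compose [OF cd c cd'(1) [OF p(1)], of e "\<lambda>x. x"]
          smooth_at_charts_compose [OF cd ce, of "\<lambda>x. x" p c "\<lambda>x. x"] cd'(2) [OF p(1)] by blast+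
    qed
    then show ?thesis by (simp add: compatible_iff_smooth_at_charts [OF c ce])
  qed
  then show "c \<in> max_atlas A"
    using c d by (auto simp: max_atlas_def mcarrier_def)
qed

lemma mcarrier_restrict_atlas: "mcarrier (restrict_atlas A S) = mcarrier A \<inter> S"
proof -
  have "restrict_atlas A S = (\<lambda>c. (fst c \<inter> S, snd c)) ` A"
    unfolding restrict_atlas_def by (rule Setcompr_eq_image)
  then show ?thesis by (auto simp: mcarrier_def)
qed

lemma atlas_restrict_atlas: "atlas A \<Longrightarrow> openin (mtopology A) S \<Longrightarrow> atlas (restrict_atlas A S)"
  using atlas_subset [OF atlas_max_atlas] restrict_atlas_subset_max_atlas by blast

lemma smooth_at_from_restrict_atlas:
  "atlas A \<Longrightarrow> openin (mtopology A) S \<Longrightarrow> p \<in> mcarrier A \<Longrightarrow> p \<in> S \<Longrightarrow>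
    smooth_at (restrict_atlas A S) A (\<lambda>x. x) p"
  by (rule smooth_at_id_max_atlas [of A])
    (simp_all add: atlas_subset_max_atlas restrict_atlas_subset_max_atlas mcarrier_restrict_atlas)

lemma smooth_at_into_restrict_atlas:
  "atlas A \<Longrightarrow> openin (mtopology A) S \<Longrightarrow> p \<in> mcarrier A \<Longrightarrow> p \<in> S \<Longrightarrow>
    smooth_at A (restrict_atlas A S) (\<lambda>x. x) p"
  by (rule smooth_at_id_max_atlas [of A])
    (simp_all add: atlas_subset_max_atlas restrict_atlas_subset_max_atlas mcarrier_restrict_atlas)

definition prod_chart :: "('a, 'e) chart \<Rightarrow> ('b, 'f) chart \<Rightarrow> ('a \<times> 'b, 'e \<times> 'f) chart" where
  "prod_chart c d = (fst c \<times> fst d, map_prod (snd c) (snd d))"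

lemma fst_prod_chart [simp]: "fst (prod_chart c d) = fst c \<times> fst d"
  by (simp add: prod_chart_def)

lemma snd_prod_chart [simp]: "snd (prod_chart c d) p = (snd c (fst p), snd d (snd p))"
  by (cases p) (simp add: prod_chart_def)

lemma prod_atlas_eq: "prod_atlas A B = (\<Union>c\<in>A. prod_chart c ` B)"
  unfolding prod_atlas_def prod_chart_def by blast

lemma prod_chart_in_prod_atlas: "c \<in> A \<Longrightarrow> d \<in> B \<Longrightarrow> prod_chart c d \<in> prod_atlas A B"
  unfolding prod_atlas_eq by blast

lemma mcarrier_prod_atlas: "mcarrier (prod_atlas A B) = mcarrier A \<times> mcarrier B"
  unfolding mcarrier_def prod_atlas_eq by fastforce

lemma prod_chart_image: "snd (prod_chart c d) ` (S \<times> T) = snd c ` S \<times> snd d ` T"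
  unfolding prod_chart_def snd_conv by (rule map_prod_surj_on) simp_all

lemma chart_prod_chart:
  assumes "chart c" "chart d"
  shows "chart (prod_chart c d)"
  using assms unfolding chart_def fst_prod_chart prod_chart_image
  by (auto simp: open_Times inj_on_def)

lemma chart_inv_prod_chart:
  assumes "chart c" "chart d" "y \<in> snd c ` fst c" "z \<in> snd d ` fst d"
  shows "chart_inv (prod_chart c d) (y, z) = (chart_inv c y, chart_inv d z)"
proof -
  obtain x w where "x \<in> fst c" "w \<in> fst d" "y = snd c x" "z = snd d w" using assms by blast
  then show ?thesis
    using assms chart_inv_coord [OF chart_prod_chart [OF assms(1,2)], of "(x, w)"]
    by (simp add: chart_inv_coord)
qed

lemma smooth_at_charts_fst:
  assumes "chart c" "chart d" "p \<in> fst c \<times> fst d"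
  shows "smooth_at_charts (prod_chart c d) c fst p"
proof -
  let ?W = "snd c ` fst c \<times> snd d ` fst d"
  have op: "open ?W" using assms by (auto simp: chart_def intro: open_Times)
  have inv: "fst (chart_inv (prod_chart c d) w) = chart_inv c (fst w)" "fst w \<in> snd c ` fst c"
    if "w \<in> ?W" for w
    using chart_inv_prod_chart [OF assms(1,2), of "fst w" "snd w"] that by (auto simp: mem_Times_iff)
  show ?thesis
  proof (rule smooth_at_chartsI [OF _ op])
    show "smooth_on ?W (\<lambda>w. snd c (fst (chart_inv (prod_chart c d) w)))"
      by (rule smooth_on_cong [OF op smooth_on_bounded_linear [OF op bounded_linear_fst]])
        (use inv coord_chart_inv in metis)
    show "fst (chart_inv (prod_chart c d) w) \<in> fst c" if "w \<in> ?W" for w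
      using inv [OF that] chart_inv_in by metis
  qed (use assms(3) in \<open>auto simp: prod_chart_image simp del: snd_prod_chart\<close>, auto simp: mem_Times_iff)
qed

lemma smooth_at_charts_snd:
  assumes "chart c" "chart d" "p \<in> fst c \<times> fst d"
  shows "smooth_at_charts (prod_chart c d) d snd p"
proof -
  let ?W = "snd c ` fst c \<times> snd d ` fst d"
  have op: "open ?W" using assms by (auto simp: chart_def intro: open_Times)
  have inv: "snd (chart_inv (prod_chart c d) w) = chart_inv d (snd w)" "snd w \<in> snd d ` fst d"
    if "w \<in> ?W" for w
    using chart_inv_prod_chart [OF assms(1,2), of "fst w" "snd w"] that by (auto simp: mem_Times_iff)
  show ?thesis
  proof (rule smooth_at_chartsI [OF _ op])
    show "smooth_on ?W (\<lambda>w. snd d (snd (chart_inv (prod_chart c d) w)))"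
      by (rule smooth_on_cong [OF op smooth_on_bounded_linear [OF op bounded_linear_snd]])
        (use inv coord_chart_inv in metis)
    show "snd (chart_inv (prod_chart c d) w) \<in> fst d" if "w \<in> ?W" for w
      using inv [OF that] chart_inv_in by metis
  qed (use assms(3) in \<open>auto simp: prod_chart_image simp del: snd_prod_chart\<close>, auto simp: mem_Times_iff)
qed

lemma compatible_prod_chart:
  assumes "chart c" "chart d" "chart c'" "chart d'" "compatible c c'" "compatible d d'"
  shows "compatible (prod_chart c d) (prod_chart c' d')"
proof -
  have *: "smooth_at_charts (prod_chart c d) (prod_chart c' d') (\<lambda>x. x) p"
    if ch: "chart c" "chart d" "compatible c c'" "compatible d d'"
      and p: "p \<in> fst c \<times> fst d" "p \<in> fst c' \<times> fst d'"
    for c c' :: "('a, 'b) chart" and d d' :: "('c, 'd) chart" and p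
  proof -
    have m: "fst p \<in> fst c" "fst p \<in> fst c'" "snd p \<in> fst d" "snd p \<in> fst d'" using p by auto
    have "smooth_at_charts (prod_chart c d) c' fst p"
      by (rule smooth_at_charts_compose [OF ch(1) chart_prod_chart [OF ch(1,2)]
          smooth_at_charts_fst [OF ch(1,2) p(1)] compatible_imp_smooth_at_charts [OF ch(1,3) m(1,2)]])
    moreover have "smooth_at_charts (prod_chart c d) d' snd p"
      by (rule smooth_at_charts_compose [OF ch(2) chart_prod_chart [OF ch(1,2)]
          smooth_at_charts_snd [OF ch(1,2) p(1)] compatible_imp_smooth_at_charts [OF ch(2,4) m(3,4)]])
    ultimately show ?thesis
      using smooth_at_charts_Pair [OF chart_prod_chart [OF ch(1,2)], of c' fst p d' snd]
      by (simp flip: prod_chart_def)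
  qed
  show ?thesis
    using * [of c d c' d'] * [of c' d' c d] assms compatible_sym
    by (simp add: compatible_iff_smooth_at_charts chart_prod_chart)
qed

lemma atlas_prod_atlas:
  assumes "atlas A" "atlas B"
  shows "atlas (prod_atlas A B)"
  using assms unfolding atlas_def prod_atlas_eq
  by (simp add: chart_prod_chart compatible_prod_chart)

lemma max_atlas_prod:
  assumes "atlas A" "atlas B" "c \<in> max_atlas A" "d \<in> max_atlas B"
  shows "prod_chart c d \<in> max_atlas (prod_atlas A B)"
proof -
  have c: "chart c" "fst c \<subseteq> mcarrier A" "\<forall>c'\<in>A. compatible c c'"
    and d: "chart d" "fst d \<subseteq> mcarrier B" "\<forall>d'\<in>B. compatible d d'"
    using assms by (auto simp: max_atlas_def)
  have "compatible (prod_chart c d) e" if e: "e \<in> prod_atlas A B" for e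
  proof -
    obtain c' d' where "c' \<in> A" "d' \<in> B" "e = prod_chart c' d'"
      using e unfolding prod_atlas_eq by blast
    then show ?thesis using c d assms by (simp add: compatible_prod_chart atlas_chart)
  qed
  then show ?thesis
    using c d by (simp add: max_atlas_def chart_prod_chart mcarrier_prod_atlas Sigma_mono)
qed

lemma smooth_at_fst:
  assumes A: "atlas A" and B: "atlas B" and p: "p \<in> mcarrier A \<times> mcarrier B"
  shows "smooth_at (prod_atlas A B) A fst p"
proof -
  have m: "fst p \<in> mcarrier A" "snd p \<in> mcarrier B" using p by auto
  obtain c where c: "c \<in> A" "fst p \<in> fst c" using m(1) by (rule mcarrier_chartE)
  obtain d where d: "d \<in> B" "snd p \<in> fst d" using m(2) by (rule mcarrier_chartE)
  have "smooth_at_charts (prod_chart c d) c fst p"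
    using A B c d by (intro smooth_at_charts_fst) (simp_all add: atlas_chart mem_Times_iff)
  then show ?thesis by (rule smooth_atI [OF prod_chart_in_prod_atlas [OF c(1) d(1)] c(1)])
qed

lemma smooth_at_snd:
  assumes A: "atlas A" and B: "atlas B" and p: "p \<in> mcarrier A \<times> mcarrier B"
  shows "smooth_at (prod_atlas A B) B snd p"
proof -
  have m: "fst p \<in> mcarrier A" "snd p \<in> mcarrier B" using p by auto
  obtain c where c: "c \<in> A" "fst p \<in> fst c" using m(1) by (rule mcarrier_chartE)
  obtain d where d: "d \<in> B" "snd p \<in> fst d" using m(2) by (rule mcarrier_chartE)
  have "smooth_at_charts (prod_chart c d) d snd p"
    using A B c d by (intro smooth_at_charts_snd) (simp_all add: atlas_chart mem_Times_iff)
  then show ?thesis by (rule smooth_atI [OF prod_chart_in_prod_atlas [OF c(1) d(1)] d(1)])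
qed

lemma smooth_at_Pair:
  assumes at: "atlas A" "atlas B" "atlas C" and f: "smooth_at A B f p" and g: "smooth_at A C g p"
  shows "smooth_at A (prod_atlas B C) (\<lambda>x. (f x, g x)) p"
proof -
  obtain c d where c: "c \<in> A" "d \<in> B" "chart c" "p \<in> fst c" "smooth_at_charts c d f p"
    by (rule smooth_atE [OF f at(1)]) blast
  obtain c' e where e: "c' \<in> A" "e \<in> C" "smooth_at_charts c' e g p"
    by (rule smooth_atE [OF g at(1)]) blast
  have "smooth_at_charts c e g p"
    by (rule smooth_at_charts_change_source [OF at(1) e(1) c(1,4) e(3)])
  from smooth_at_charts_Pair [OF c(3,5) this]
  have "smooth_at_charts c (prod_chart d e) (\<lambda>x. (f x, g x)) p" by (simp only: prod_chart_def)
  then show ?thesis by (rule smooth_atI [OF c(1) prod_chart_in_prod_atlas [OF c(2) e(2)]])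
qed

lemma smooth_at_const:
  assumes A: "atlas A" and B: "atlas B" and p: "p \<in> mcarrier A" and b: "b \<in> mcarrier B"
  shows "smooth_at A B (\<lambda>x. b) p"
proof -
  obtain c where c: "c \<in> A" "p \<in> fst c" using p by (rule mcarrier_chartE)
  obtain d where d: "d \<in> B" "b \<in> fst d" using b by (rule mcarrier_chartE)
  have op: "open (snd c ` fst c)" using A c by (simp add: atlas_def chart_def)
  have "smooth_at_charts c d (\<lambda>x. b) p"
    by (rule smooth_at_chartsI [where W = "snd c ` fst c"]) (use c d op in \<open>auto intro: smooth_on_const\<close>)
  then show ?thesis by (rule smooth_atI [OF c(1) d(1)])
qed

lemma openin_smooth_at_preimage:
  assumes A: "atlas A" and B: "atlas B" and S: "openin (mtopology A) S"
    and f: "\<And>x. x \<in> S \<Longrightarrow> smooth_at A B f x" and T: "openin (mtopology B) T"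
  shows "openin (mtopology A) {x \<in> S. f x \<in> T}"
proof -
  let ?R = "restrict_atlas A S"
  have R: "atlas ?R" by (rule atlas_restrict_atlas [OF A S])
  have sub: "S \<subseteq> mcarrier A" using S A by (simp add: openin_mtopology)
  have cR: "mcarrier ?R = S" using sub by (auto simp: mcarrier_restrict_atlas)
  have "smooth_at ?R B f x" if "x \<in> S" for x
    using smooth_at_compose [OF R A B smooth_at_from_restrict_atlas [OF A S]] f that sub by blast
  then have "continuous_map (mtopology ?R) (mtopology B) f"
    using smooth_map_iff_smooth_at [OF R B, of f] cR unfolding smooth_map_def by blast
  from openin_continuous_map_preimage [OF this T]
  have op: "openin (mtopology ?R) {x \<in> S. f x \<in> T}"
    by (simp add: topspace_mtopology R cR)
  have "open (snd c ` ({x \<in> S. f x \<in> T} \<inter> fst c))" if "c \<in> A" for c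
  proof -
    have "(fst c \<inter> S, snd c) \<in> ?R" using that unfolding restrict_atlas_def by blast
    from openin_mtopology_coord [OF R op this]
    have "open (snd c ` (fst c \<inter> S \<inter> {x \<in> S. f x \<in> T}))" by simp
    moreover have "fst c \<inter> S \<inter> {x \<in> S. f x \<in> T} = {x \<in> S. f x \<in> T} \<inter> fst c" by blast
    ultimately show ?thesis by simp
  qed
  then show ?thesis using sub by (auto simp: openin_mtopology A)
qed

section \<open>Model spaces as manifolds\<close>

text \<open>
  With the model space itself viewed as a manifold, coordinate maps and their inverses are smooth
  maps like any others, and computations in coordinates become compositions of smooth maps.
\<close>

definition model_atlas :: "('e, 'e::model_space) atlas" where
  "model_atlas = {(UNIV, \<lambda>x. x)}"

lemma chart_model: "chart (UNIV, \<lambda>x :: 'e::model_space. x)"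
  by (simp add: chart_def)

lemma chart_inv_model [simp]: "chart_inv (UNIV, \<lambda>x :: 'e::model_space. x) y = y"
  using chart_inv_coord [OF chart_model, of y] by simp

lemma atlas_model_atlas: "atlas (model_atlas :: ('e, 'e::model_space) atlas)"
  by (simp add: atlas_def model_atlas_def chart_model compatible_iff_smooth_at_charts
      smooth_at_charts_id)

lemma mcarrier_model_atlas [simp]: "mcarrier (model_atlas :: ('e, 'e::model_space) atlas) = UNIV"
  by (simp add: mcarrier_def model_atlas_def)

lemma openin_model_atlas: "openin (mtopology model_atlas) S \<longleftrightarrow> open S"
  by (simp add: openin_mtopology atlas_model_atlas) (simp add: model_atlas_def)

lemma smooth_at_model_iff:
  "smooth_at model_atlas model_atlas f x \<longleftrightarrow> (\<exists>W. open W \<and> x \<in> W \<and> smooth_on W f)"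
  by (auto simp: smooth_at_def model_atlas_def smooth_at_charts_def comp_def)

lemma smooth_at_linear:
  fixes f :: "'a::model_space \<Rightarrow> 'b::model_space"
  assumes "linear f"
  shows "smooth_at model_atlas model_atlas f x"
  unfolding smooth_at_model_iff
  using smooth_on_bounded_linear [OF open_UNIV linear_imp_bounded_linear [OF assms]] by blast

lemma smooth_at_coord:
  assumes A: "atlas A" and c: "c \<in> A" "p \<in> fst c"
  shows "smooth_at A model_atlas (snd c) p"
proof -
  have op: "open (snd c ` fst c)" using A c by (simp add: atlas_def chart_def)
  have "smooth_at_charts c (UNIV, \<lambda>x. x) (snd c) p"
    by (rule smooth_at_chartsI [where W = "snd c ` fst c"])
      (use c op in \<open>auto intro!: smooth_on_cong [OF op smooth_on_id [OF op]] coord_chart_inv\<close>)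
  with c show ?thesis by (intro smooth_atI) (auto simp: model_atlas_def)
qed

lemma smooth_at_chart_inv:
  assumes A: "atlas A" and c: "c \<in> A" "y \<in> snd c ` fst c"
  shows "smooth_at model_atlas A (chart_inv c) y"
proof -
  have op: "open (snd c ` fst c)" using A c by (simp add: atlas_def chart_def)
  have "smooth_at_charts (UNIV, \<lambda>x. x) c (chart_inv c) y"
    by (rule smooth_at_chartsI [where W = "snd c ` fst c"])
      (use c op in \<open>auto intro!: smooth_on_cong [OF op smooth_on_id [OF op]] coord_chart_inv chart_inv_in\<close>)
  with c show ?thesis by (intro smooth_atI) (auto simp: model_atlas_def)
qed

text \<open>
  A diffeomorphism between an open set and an open subset of the model space belongs to the maximal
  atlas. The charts of \<open>E\<close> built from a trivialization are recognized by this criterion.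
\<close>

lemma chart_in_max_atlasI:
  fixes A :: "('a, 'e::model_space) atlas"
  assumes A: "atlas A" and D: "openin (mtopology A) D" and k: "inj_on k D" "open (k ` D)"
    and sk: "\<And>x. x \<in> D \<Longrightarrow> smooth_at A model_atlas k x"
    and si: "\<And>x. x \<in> D \<Longrightarrow> smooth_at model_atlas A (inv_into D k) (k x)"
  shows "(D, k) \<in> max_atlas A"
proof -
  have ch: "chart (D, k)" using k by (simp add: chart_def)
  have mo: "(UNIV, \<lambda>x. x) \<in> (model_atlas :: ('e, 'e) atlas)" by (simp add: model_atlas_def)
  have "compatible (D, k) c" if c: "c \<in> A" for c
  proof -
    have cc: "chart c" using A c by (simp add: atlas_chart)
    have "smooth_at_charts c (D, k) (\<lambda>x. x) p" if p: "p \<in> fst c" "p \<in> D" for p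
    proof -
      have "smooth_at_charts c (UNIV, \<lambda>x. x) k p"
        using smooth_atD [OF A atlas_model_atlas sk [OF p(2)] c p(1) mo] by simp
      then obtain W where W: "open W" "snd c p \<in> W" "W \<subseteq> snd c ` fst c"
        "smooth_on W (\<lambda>y. k (chart_inv c y))"
        by (auto simp: smooth_at_charts_def comp_def)
      let ?W = "W \<inter> snd c ` (fst c \<inter> D)"
      have "open ?W" using W openin_mtopology_coord [OF A D c] by blast
      then show ?thesis
        by (intro smooth_at_chartsI [where W = ?W])
          (use W p cc in \<open>auto simp: chart_inv_coord intro: smooth_on_subset\<close>)
    qed
    moreover have "smooth_at_charts (D, k) c (\<lambda>x. x) p" if p: "p \<in> fst c" "p \<in> D" for p
    proof -
      have "inv_into D k (k p) = p" using k p by simp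
      then have "smooth_at_charts (UNIV, \<lambda>x. x) c (inv_into D k) (k p)"
        using smooth_atD [OF atlas_model_atlas A si [OF p(2)] mo _ c] p by simp
      then obtain W where W: "open W" "k p \<in> W" "\<And>y. y \<in> W \<Longrightarrow> inv_into D k y \<in> fst c"
        "smooth_on W (\<lambda>y. snd c (inv_into D k y))"
        by (auto simp: smooth_at_charts_def comp_def)
      let ?W = "W \<inter> k ` D"
      have "open ?W" using W k by blast
      then show ?thesis
        by (intro smooth_at_chartsI [where W = ?W])
          (use W p in \<open>auto simp: chart_inv_def intro: smooth_on_subset\<close>)
    qed
    ultimately show ?thesis using ch cc by (simp add: compatible_iff_smooth_at_charts)
  qed
  moreover have "D \<subseteq> mcarrier A" using D A by (simp add: openin_mtopology)
  ultimately show ?thesis using ch by (simp add: max_atlas_def)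
qed

section \<open>Embedded submanifolds\<close>

lemma slice_chart_coords:
  assumes "slice_chart A S c j" "p \<in> fst c" "p \<in> S"
  shows "j (inv_into UNIV j (snd c p)) = snd c p"
proof -
  have "snd c p \<in> range j" using assms unfolding slice_chart_def by blast
  then show ?thesis by (rule f_inv_into_f)
qed

text \<open>
  In the chart \<open>s\<close> induced by a slice chart \<open>c\<close>, the inclusion of \<open>S\<close> has the linear
  coordinate expression \<open>j\<close>.
\<close>

lemma slice_chart_induced:
  fixes j :: "'k::model_space \<Rightarrow> 'e::model_space"
  assumes sl: "slice_chart A S c j"
  defines "s \<equiv> (fst c \<inter> S, inv_into UNIV j \<circ> snd c)"
  shows "chart s" and "\<And>p. p \<in> fst c \<Longrightarrow> p \<in> S \<Longrightarrow> smooth_at_charts s c (\<lambda>x. x) p"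
proof -
  have c: "chart c" and j: "linear j" "inj j"
    and im: "snd c ` (fst c \<inter> S) = snd c ` fst c \<inter> range j"
    using sl by (auto simp: slice_chart_def max_atlas_def)
  note jc = slice_chart_coords [OF sl]
  \<comment> \<open>The slice condition makes the coordinate image of \<open>S\<close> the preimage of an open set under \<open>j\<close>.\<close>
  have img: "snd s ` fst s = j -` (snd c ` fst c)"
  proof -
    have "snd s ` fst s = inv_into UNIV j ` (snd c ` fst c \<inter> range j)"
      unfolding im [symmetric] by (simp add: s_def image_comp)
    also have "\<dots> = j -` (snd c ` fst c)"
    proof (intro equalityI subsetI)
      fix z assume "z \<in> j -` (snd c ` fst c)"
      then show "z \<in> inv_into UNIV j ` (snd c ` fst c \<inter> range j)"
        using inv_f_f [OF j(2), of z] by (metis IntI imageI rangeI vimageD)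
    next
      fix z assume "z \<in> inv_into UNIV j ` (snd c ` fst c \<inter> range j)"
      then obtain e where "e \<in> snd c ` fst c \<inter> range j" "z = inv_into UNIV j e" by (rule imageE)
      then show "z \<in> j -` (snd c ` fst c)" by (simp add: f_inv_into_f)
    qed
    finally show ?thesis .
  qed
  have "continuous_on UNIV j"
    using linear_imp_bounded_linear [OF j(1)] by (rule linear_continuous_on)
  then have op: "open (snd s ` fst s)"
    unfolding img using c by (intro open_vimage) (auto simp: chart_def)
  have inj: "inj_on (snd s) (fst s)"
  proof (rule inj_onI)
    fix x y assume xy: "x \<in> fst s" "y \<in> fst s" "snd s x = snd s y"
    then have m: "x \<in> fst c" "y \<in> fst c" "x \<in> S" "y \<in> S"
      "inv_into UNIV j (snd c x) = inv_into UNIV j (snd c y)" by (auto simp: s_def)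
    then have "snd c x = snd c y" using jc [of x] jc [of y] by metis
    with c m show "x = y" by (simp add: chart_def inj_on_def)
  qed
  show s: "chart s" using op inj by (simp add: chart_def)
  fix p assume p: "p \<in> fst c" "p \<in> S"
  show "smooth_at_charts s c (\<lambda>x. x) p"
  proof (rule smooth_at_chartsI [where W = "snd s ` fst s"])
    show "p \<in> fst s" "snd s p \<in> snd s ` fst s" using p by (auto simp: s_def)
    show "chart_inv s y \<in> fst c" if "y \<in> snd s ` fst s" for y
      using chart_inv_in [OF that] by (simp add: s_def)
    have "snd c (chart_inv s y) = j y" if "y \<in> snd s ` fst s" for y
    proof -
      have "chart_inv s y \<in> fst s" by (rule chart_inv_in [OF that])
      then show ?thesis
        using jc [of "chart_inv s y"] coord_chart_inv [OF that] by (simp add: s_def)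
    qed
    then show "smooth_on (snd s ` fst s) (\<lambda>y. snd c (chart_inv s y))"
      by (rule smooth_on_cong [OF op smooth_on_bounded_linear [OF op linear_imp_bounded_linear [OF j(1)]]])
  qed (use op in auto)
qed

lemma submanifold_atlasE:
  assumes "s \<in> submanifold_atlas A S"
  obtains c j where "slice_chart A S c j" "s = (fst c \<inter> S, inv_into UNIV j \<circ> snd c)"
  using assms unfolding submanifold_atlas_def mem_Collect_eq by blast

text \<open>
  A transition map between induced charts is one of the ambient manifold, preceded by \<open>j\<close> and
  followed by the inverse of \<open>j'\<close> on its range. Off the range of \<open>j'\<close> that inverse has arbitrary
  values, so it is replaced by a linear left inverse of \<open>j'\<close>, which agrees with it on the points
  in question and is smooth everywhere.
\<close>

lemma atlas_submanifold_atlas: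
  fixes A :: "('a, 'e::model_space) atlas"
  assumes A: "atlas A"
  shows "atlas (submanifold_atlas A S :: ('a, 'k::model_space) atlas)"
proof -
  have "smooth_at_charts (fst c \<inter> S, inv_into UNIV j \<circ> snd c)
      (fst c' \<inter> S, inv_into UNIV j' \<circ> snd c') (\<lambda>x. x) p"
    if sl: "slice_chart A S c j" "slice_chart A S c' j'" and p: "p \<in> fst c" "p \<in> fst c'" "p \<in> S"
    for c c' p and j j' :: "'k \<Rightarrow> 'e"
  proof -
    let ?s = "(fst c \<inter> S, inv_into UNIV j \<circ> snd c)"
    have mx: "c \<in> max_atlas A" "c' \<in> max_atlas A" using sl by (auto simp: slice_chart_def)
    have "smooth_at_charts ?s c' (\<lambda>x. x) p"
      by (rule smooth_at_charts_change_target [OF atlas_max_atlas [OF A] mx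
          slice_chart_induced(1) [OF sl(1)] p(2) slice_chart_induced(2) [OF sl(1) p(1,3)]])
    then obtain W where W: "open W" "snd ?s p \<in> W" "W \<subseteq> snd ?s ` fst ?s"
      "\<And>y. y \<in> W \<Longrightarrow> chart_inv ?s y \<in> fst c'" "smooth_on W (\<lambda>y. snd c' (chart_inv ?s y))"
      by (rule smooth_at_chartsE) blast
    have "linear j'" "inj j'" using sl by (auto simp: slice_chart_def)
    then obtain l where l: "linear l" "l \<circ> j' = id"
      using linear_injective_left_inverse by blast
    have S: "chart_inv ?s y \<in> S" if "y \<in> W" for y
      using chart_inv_in [of y ?s] W(3) that by auto
    have sm: "smooth_on W (\<lambda>y. l (snd c' (chart_inv ?s y)))"
      using smooth_on_compose [OF W(1,5) smooth_on_bounded_linear [OF open_UNIV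
            linear_imp_bounded_linear [OF l(1)]]] by simp
    have eq: "inv_into UNIV j' (snd c' (chart_inv ?s y)) = l (snd c' (chart_inv ?s y))" if "y \<in> W" for y
      using slice_chart_coords [OF sl(2) W(4) [OF that] S [OF that]] l(2)
      by (metis comp_apply id_apply)
    show ?thesis
      using W S p by (intro smooth_at_chartsI [where W = W])
        (auto intro!: smooth_on_cong [OF W(1) sm] eq)
  qed
  note sm = this
  have ch: "chart s" if "s \<in> submanifold_atlas A S" for s :: "('a, 'k) chart"
    using that by (elim submanifold_atlasE) (simp add: slice_chart_induced(1))
  have "smooth_at_charts s s' (\<lambda>x. x) p"
    if "s \<in> submanifold_atlas A S" "s' \<in> submanifold_atlas A S" "p \<in> fst s" "p \<in> fst s'"
    for s s' :: "('a, 'k) chart" and p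
    using that by (elim submanifold_atlasE) (simp add: sm)
  then show ?thesis
    unfolding atlas_def by (simp add: ch compatible_iff_smooth_at_charts)
qed

lemma mcarrier_submanifold_atlas: "mcarrier (submanifold_atlas A S) \<subseteq> S"
  by (auto simp: mcarrier_def submanifold_atlas_def)

lemma smooth_at_submanifold_inclusion:
  fixes A :: "('a, 'e::model_space) atlas"
  assumes A: "atlas A" and p: "p \<in> mcarrier (submanifold_atlas A S :: ('a, 'k::model_space) atlas)"
  shows "smooth_at (submanifold_atlas A S :: ('a, 'k) atlas) A (\<lambda>x. x) p"
proof -
  let ?B = "submanifold_atlas A S :: ('a, 'k) atlas"
  from p obtain s where s: "s \<in> ?B" "p \<in> fst s" by (rule mcarrier_chartE)
  obtain c j where c: "slice_chart A S c j" "s = (fst c \<inter> S, inv_into UNIV j \<circ> snd c)"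
    by (rule submanifold_atlasE [OF s(1)])
  then have mx: "c \<in> max_atlas A" by (simp add: slice_chart_def)
  have pc: "p \<in> fst c" "p \<in> S" using s c by auto
  have "smooth_at ?B (max_atlas A) (\<lambda>x. x) p"
    using smooth_atI [OF s(1) mx] slice_chart_induced(2) [OF c(1) pc] by (simp add: c(2))
  moreover have "smooth_at (max_atlas A) A (\<lambda>x. x) p"
  proof (rule smooth_at_id_max_atlas [OF A])
    show "p \<in> mcarrier A" using mx pc by (auto simp: max_atlas_def)
    then show "p \<in> mcarrier (max_atlas A)" by (simp add: mcarrier_max_atlas A)
  qed (simp_all add: A atlas_subset_max_atlas)
  ultimately show ?thesis
    by (rule smooth_at_compose [OF atlas_submanifold_atlas [OF A] atlas_max_atlas [OF A] A])
qed

section \<open>Differentials in coordinates\<close>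

definition coord_deriv ::
  "('a, 'e::model_space) chart \<Rightarrow> ('b, 'f::model_space) chart \<Rightarrow> ('a \<Rightarrow> 'b) \<Rightarrow> 'a \<Rightarrow> 'e \<Rightarrow> 'f" where
  "coord_deriv c d f p = frechet_derivative (\<lambda>y. snd d (f (chart_inv c y))) (at (snd c p))"

lemma frechet_derivative_transition:
  "frechet_derivative (transition c c') (at (snd c p)) = coord_deriv c c' (\<lambda>x. x) p"
  by (simp add: transition_def coord_deriv_def comp_def)

lemma coord_deriv_works:
  assumes "smooth_at_charts c d f p"
  shows "((\<lambda>y. snd d (f (chart_inv c y))) has_derivative coord_deriv c d f p) (at (snd c p))"
  using assms unfolding coord_deriv_def
  by (elim smooth_at_chartsE) (rule smooth_on_has_derivative)

lemma linear_coord_deriv: "smooth_at_charts c d f p \<Longrightarrow> linear (coord_deriv c d f p)"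
  by (rule has_derivative_linear [OF coord_deriv_works])

lemma coord_deriv_compose:
  assumes c: "chart c" and d: "chart d"
    and f: "smooth_at_charts c d f p" and g: "smooth_at_charts d e g (f p)"
  shows "coord_deriv c e (\<lambda>x. g (f x)) p v = coord_deriv d e g (f p) (coord_deriv c d f p v)"
proof -
  obtain W where W: "p \<in> fst c" "open W" "snd c p \<in> W" "\<And>y. y \<in> W \<Longrightarrow> f (chart_inv c y) \<in> fst d"
    by (rule smooth_at_chartsE [OF f]) blast
  let ?F = "\<lambda>y. snd d (f (chart_inv c y))" and ?G = "\<lambda>z. snd e (g (chart_inv d z))"
  have "?F (snd c p) = snd d (f p)" using c W by (simp add: chart_inv_coord)
  then have "((\<lambda>y. ?G (?F y)) has_derivative (\<lambda>v. coord_deriv d e g (f p) (coord_deriv c d f p v)))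
      (at (snd c p))"
    using has_derivative_compose [OF coord_deriv_works [OF f], of ?G "coord_deriv d e g (f p)"]
      coord_deriv_works [OF g] by simp
  then have "((\<lambda>y. snd e (g (f (chart_inv c y)))) has_derivative
      (\<lambda>v. coord_deriv d e g (f p) (coord_deriv c d f p v))) (at (snd c p))"
    by (rule has_derivative_transform_within_open [OF _ W(2,3)])
      (use W(4) d in \<open>simp add: chart_inv_coord\<close>)
  from frechet_derivative_eqI [OF this] show ?thesis
    by (simp add: coord_deriv_def [of c e])
qed

lemma coord_deriv_eq_id:
  assumes c: "chart c" and p: "p \<in> fst c" "p \<in> S" and S: "open (snd c ` (fst c \<inter> S))"
    and f: "\<And>x. x \<in> S \<Longrightarrow> f x = x"
  shows "coord_deriv c d f p = coord_deriv c d (\<lambda>x. x) p"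
  unfolding coord_deriv_def
  by (rule frechet_derivative_cong_open [OF S]) (use assms in \<open>auto simp: chart_inv_coord\<close>)

lemma coord_deriv_id:
  assumes c: "chart c" "p \<in> fst c"
  shows "coord_deriv c c (\<lambda>x. x) p v = v"
proof -
  have op: "open (snd c ` fst c)" using c by (simp add: chart_def)
  have "coord_deriv c c (\<lambda>x. x) p = frechet_derivative (\<lambda>y. y) (at (snd c p))"
    unfolding coord_deriv_def
    by (rule frechet_derivative_cong_open [OF op]) (use c in \<open>auto intro: coord_chart_inv\<close>)
  also have "\<dots> = (\<lambda>v. v)" by (rule frechet_derivative_eqI) simp
  finally show ?thesis by simp
qed

lemma charts_atI: "c \<in> A \<Longrightarrow> p \<in> fst c \<Longrightarrow> c \<in> charts_at A p"
  by (simp add: charts_at_def)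

text \<open>
  Differentiating \<open>f \<circ> s = id\<close> shows that the differential of the local section \<open>s\<close> is a right
  inverse of the differential of \<open>f\<close>. As tangent vectors are families of coordinate vectors, the
  preimage of \<open>w\<close> is given by its coordinates in the chart selected by \<open>tangent_map\<close>.
\<close>

lemma tangent_map_surj_of_local_section:
  assumes A: "atlas A" and B: "atlas B" and f: "smooth_at A B f p"
    and s: "smooth_at B A s (f p)" "s (f p) = p"
    and S: "openin (mtopology B) S" "f p \<in> S" "\<And>q. q \<in> S \<Longrightarrow> f (s q) = q"
  shows "tangent_map A B f p ` tangent_space A p = tangent_space B (f p)"
proof -
  define c where "c = (SOME c. c \<in> charts_at A p)"
  obtain c0 d where c0: "c0 \<in> A" "p \<in> fst c0" and d: "d \<in> B" "f p \<in> fst d"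
    by (rule smooth_atE [OF f A]) blast
  have "c \<in> charts_at A p"
    unfolding c_def by (rule someI [of _ c0]) (use c0 in \<open>simp add: charts_at_def\<close>)
  then have c: "c \<in> A" "p \<in> fst c" "chart c" by (auto simp: charts_at_def intro: atlas_chart [OF A])
  have f_at: "smooth_at_charts c e f p" if "e \<in> charts_at B (f p)" for e
    using smooth_atD [OF A B f c(1,2)] that by (simp add: charts_at_def)
  have trans: "smooth_at_charts a b (\<lambda>x. x) q"
    if "atlas C" "a \<in> charts_at C q" "b \<in> charts_at C q" for C :: "('z, 'w::model_space) atlas" and a b q
    using that by (intro compatible_imp_smooth_at_charts)
      (auto simp: charts_at_def atlas_chart atlas_compatible)
  have tm: "tangent_map A B f p v =
      (\<lambda>e. if e \<in> charts_at B (f p) then coord_deriv c e f p (v c) else 0)" for v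
    unfolding tangent_map_def c_def [symmetric] coord_deriv_def comp_def Let_def ..
  show ?thesis
  proof (intro equalityI subsetI)
    fix w assume "w \<in> tangent_map A B f p ` tangent_space A p"
    then obtain v where w: "w = tangent_map A B f p v" by blast
    have "coord_deriv c e' f p (v c) = coord_deriv e e' (\<lambda>x. x) (f p) (coord_deriv c e f p (v c))"
      if "e \<in> charts_at B (f p)" "e' \<in> charts_at B (f p)" for e e'
    proof (rule coord_deriv_compose)
      show "chart e" using that B by (simp add: charts_at_def atlas_chart)
    qed (use c f_at trans [OF B] that in auto)
    note chain = this
    show "w \<in> tangent_space B (f p)"
      unfolding tangent_space_def mem_Collect_eq frechet_derivative_transition
    proof (intro conjI ballI allI impI)
      fix e e' assume e: "e \<in> charts_at B (f p)" "e' \<in> charts_at B (f p)"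
      show "w e' = coord_deriv e e' (\<lambda>x. x) (f p) (w e)"
        using chain [OF e] by (simp only: w tm e if_True)
    qed (simp add: w tm)
  next
    fix w assume w: "w \<in> tangent_space B (f p)"
    have dB: "d \<in> charts_at B (f p)" using d by (rule charts_atI)
    have cd: "chart d" using d B by (simp add: atlas_chart)
    let ?v = "coord_deriv d c s (f p) (w d)"
    let ?u = "coord_tvec A c p ?v"
    have cA: "c \<in> charts_at A p" using c by (simp add: charts_atI)
    have "coord_deriv c a' (\<lambda>x. x) p ?v = coord_deriv a a' (\<lambda>x. x) p (coord_deriv c a (\<lambda>x. x) p ?v)"
      if "a \<in> charts_at A p" "a' \<in> charts_at A p" for a a'
    proof (rule coord_deriv_compose)
      show "chart a" using that A by (simp add: charts_at_def atlas_chart)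
    qed (use c trans [OF A] that cA in auto)
    note chain = this
    have u: "?u \<in> tangent_space A p"
      unfolding tangent_space_def mem_Collect_eq coord_tvec_def frechet_derivative_transition
    proof (intro conjI ballI allI impI)
      fix a a' assume a: "a \<in> charts_at A p" "a' \<in> charts_at A p"
      show "(if a' \<in> charts_at A p then coord_deriv c a' (\<lambda>x. x) p ?v else 0) =
          coord_deriv a a' (\<lambda>x. x) p (if a \<in> charts_at A p then coord_deriv c a (\<lambda>x. x) p ?v else 0)"
        using chain [OF a] by (simp only: a if_True)
    qed simp
    have uc: "?u c = ?v"
      using cA c by (simp add: coord_tvec_def frechet_derivative_transition coord_deriv_id)
    have "tangent_map A B f p ?u = w"
    proof (rule ext)
      fix e
      show "tangent_map A B f p ?u e = w e"
      proof (cases "e \<in> charts_at B (f p)")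
        case True
        have s_at: "smooth_at_charts d c s (f p)"
          by (rule smooth_atD [OF B A s(1) d c(1)]) (simp add: s c)
        have "tangent_map A B f p ?u e = coord_deriv c e f (s (f p)) ?v"
          by (simp add: tm True uc s)
        also have "\<dots> = coord_deriv d e (\<lambda>q. f (s q)) (f p) (w d)"
          by (rule coord_deriv_compose [symmetric]) (use cd c s_at f_at True s in auto)
        also have "\<dots> = coord_deriv d e (\<lambda>q. q) (f p) (w d)"
          using coord_deriv_eq_id [OF cd d(2) S(2) openin_mtopology_coord [OF B S(1) d(1)],
              of "\<lambda>q. f (s q)" e] by (simp add: S(3))
        also have "\<dots> = w e"
          using w dB True
          unfolding tangent_space_def mem_Collect_eq frechet_derivative_transition by metis
        finally show ?thesis .
      next
        case False
        then have "w e = 0" using w unfolding tangent_space_def by blast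
        with False show ?thesis by (simp add: tm)
      qed
    qed
    with u show "w \<in> tangent_map A B f p ` tangent_space A p" by (metis imageI)
  qed
qed

text \<open>
  The differential of a local diffeomorphism is invertible, so the model spaces of its source and
  target, which are given as unrelated types, are isomorphic.
\<close>

lemma linear_iso_of_local_diffeo:
  fixes A :: "('a, 'e::model_space) atlas" and B :: "('b, 'f::model_space) atlas"
  assumes A: "atlas A" and B: "atlas B" and f: "smooth_at A B f p" and g: "smooth_at B A g (f p)"
    and S: "openin (mtopology A) S" "p \<in> S" "\<And>x. x \<in> S \<Longrightarrow> g (f x) = x"
    and T: "openin (mtopology B) T" "f p \<in> T" "\<And>y. y \<in> T \<Longrightarrow> f (g y) = y"
  shows "\<exists>L :: 'e \<Rightarrow> 'f. linear L \<and> bij L"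
proof -
  have gf: "g (f p) = p" using S by simp
  obtain c d where cd: "c \<in> A" "d \<in> B" "chart c" "p \<in> fst c" "f p \<in> fst d" "smooth_at_charts c d f p"
    by (rule smooth_atE [OF f A]) blast
  have d: "chart d" using cd B by (simp add: atlas_chart)
  have sg: "smooth_at_charts d c g (f p)"
    by (rule smooth_atD [OF B A g]) (simp_all add: cd gf)
  let ?L = "coord_deriv c d f p" and ?K = "coord_deriv d c g (f p)"
  have "?K (?L v) = v" for v
  proof -
    have "?K (?L v) = coord_deriv c c (\<lambda>x. g (f x)) p v"
      by (rule coord_deriv_compose [symmetric]) (use cd d sg in auto)
    also have "\<dots> = v"
      using coord_deriv_eq_id [OF cd(3,4) S(2) openin_mtopology_coord [OF A S(1) cd(1)], of "\<lambda>x. g (f x)" c]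
      by (simp add: coord_deriv_id cd S(3))
    finally show ?thesis .
  qed
  moreover have "?L (?K v) = v" for v
  proof -
    have "?L (?K v) = coord_deriv c d f (g (f p)) (?K v)" by (simp add: gf)
    also have "\<dots> = coord_deriv d d (\<lambda>x. f (g x)) (f p) v"
      by (rule coord_deriv_compose [symmetric]) (use cd d sg gf in auto)
    also have "\<dots> = v"
      using coord_deriv_eq_id [OF d cd(5) T(2) openin_mtopology_coord [OF B T(1) cd(2)], of "\<lambda>x. f (g x)" d]
      by (simp add: coord_deriv_id cd d T(3))
    finally show ?thesis .
  qed
  ultimately have "bij ?L" by (intro o_bij [of ?K]) (auto simp: fun_eq_iff)
  with linear_coord_deriv [OF cd(6)] show ?thesis by blast
qed

section \<open>Local trivializations of a fibre bundle\<close>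

text \<open>
  Everything about the structure maps is local on the base, so it is proved for a single local
  trivialization.
\<close>

locale trivialization =
  fixes E :: "('x, 'e::model_space) atlas" and \<pi> :: "'x \<Rightarrow> 'b"
    and M :: "('b, 'm::model_space) atlas" and F :: "('g, 'n::model_space) atlas"
    and U :: "'b set" and \<psi> :: "'x \<Rightarrow> 'b \<times> 'g"
  assumes atlas_E: "atlas E" and atlas_M: "atlas M" and atlas_F: "atlas F"
    and smooth_proj: "smooth_map E M \<pi>"
    and triv: "local_trivialization E \<pi> M F U \<psi>"
begin

definition total :: "'x set" where "total = {x \<in> mcarrier E. \<pi> x \<in> U}"

definition triv_inv :: "'b \<times> 'g \<Rightarrow> 'x" where "triv_inv = inv_into total \<psi>"

lemma openin_U: "openin (mtopology M) U"
  using triv by (simp add: local_trivialization_def)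

lemma U_subset: "U \<subseteq> mcarrier M"
  using openin_U atlas_M by (simp add: openin_mtopology)

lemma smooth_at_proj: "x \<in> mcarrier E \<Longrightarrow> smooth_at E M \<pi> x"
  using smooth_proj smooth_map_iff_smooth_at [OF atlas_E atlas_M] by blast

lemma openin_total: "openin (mtopology E) total"
  unfolding total_def
  using openin_smooth_at_preimage [OF atlas_E atlas_M _ smooth_at_proj openin_U, of "mcarrier E"]
    openin_topspace [of "mtopology E"] by (simp add: topspace_mtopology atlas_E)

lemma total_subset: "total \<subseteq> mcarrier E"
  by (auto simp: total_def)

lemma atlas_prod: "atlas (prod_atlas M F)"
  by (rule atlas_prod_atlas [OF atlas_M atlas_F])

lemma bij_triv: "bij_betw \<psi> total (U \<times> mcarrier F)"
proof -
  have "bij_betw \<psi> (mcarrier (restrict_atlas E total)) (mcarrier (prod_atlas (restrict_atlas M U) F))"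
    using triv by (simp add: local_trivialization_def diffeomorphism_def total_def)
  moreover have "mcarrier (restrict_atlas E total) = total" "mcarrier (restrict_atlas M U) = U"
    using total_subset U_subset by (auto simp: mcarrier_restrict_atlas)
  ultimately show ?thesis by (simp add: mcarrier_prod_atlas)
qed

lemma fst_triv: "x \<in> total \<Longrightarrow> fst (\<psi> x) = \<pi> x"
  using triv by (simp add: local_trivialization_def total_def)

lemma snd_triv_in: "x \<in> total \<Longrightarrow> snd (\<psi> x) \<in> mcarrier F"
  using bij_betwE [OF bij_triv] by (auto simp: mem_Times_iff)

lemma triv_inv_triv: "x \<in> total \<Longrightarrow> triv_inv (\<psi> x) = x"
  unfolding triv_inv_def using bij_triv by (simp add: bij_betw_def)

lemma triv_triv_inv: "z \<in> U \<times> mcarrier F \<Longrightarrow> \<psi> (triv_inv z) = z"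
  unfolding triv_inv_def using bij_triv by (simp add: bij_betw_def f_inv_into_f)

lemma triv_inv_in: "z \<in> U \<times> mcarrier F \<Longrightarrow> triv_inv z \<in> total"
  unfolding triv_inv_def using bij_triv by (metis bij_betw_def inv_into_into)

lemma proj_triv_inv: "z \<in> U \<times> mcarrier F \<Longrightarrow> \<pi> (triv_inv z) = fst z"
  using fst_triv [OF triv_inv_in] triv_triv_inv by simp

text \<open>
  The trivialization is a diffeomorphism between open submanifolds; its smoothness at a point can be
  stated with the ambient manifolds \<open>E\<close> and \<open>M \<times> F\<close> instead.
\<close>

lemma smooth_at_triv:
  assumes x: "x \<in> total"
  shows "smooth_at E (prod_atlas M F) \<psi> x"
proof -
  let ?R = "restrict_atlas E total" and ?N = "restrict_atlas M U"
  have R: "atlas ?R" by (rule atlas_restrict_atlas [OF atlas_E openin_total])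
  have N: "atlas ?N" by (rule atlas_restrict_atlas [OF atlas_M openin_U])
  have NF: "atlas (prod_atlas ?N F)" by (rule atlas_prod_atlas [OF N atlas_F])
  have xE: "x \<in> mcarrier E" using x total_subset by blast
  have xR: "x \<in> mcarrier ?R" using x xE by (simp add: mcarrier_restrict_atlas)
  have "smooth_map ?R (prod_atlas ?N F) \<psi>"
    using triv by (simp add: local_trivialization_def diffeomorphism_def total_def)
  then have \<psi>: "smooth_at ?R (prod_atlas ?N F) \<psi> x"
    using smooth_map_iff_smooth_at [OF R NF] xR by blast
  have m: "\<psi> x \<in> mcarrier ?N \<times> mcarrier F"
    using smooth_at_maps [OF R \<psi>] by (simp add: mcarrier_prod_atlas)
  then have fU: "fst (\<psi> x) \<in> mcarrier M" "fst (\<psi> x) \<in> U"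
    by (auto simp: mcarrier_restrict_atlas)
  have "smooth_at (prod_atlas ?N F) (prod_atlas M F) (\<lambda>z. (fst z, snd z)) (\<psi> x)"
    by (rule smooth_at_Pair [OF NF atlas_M atlas_F
          smooth_at_compose [OF NF N atlas_M smooth_at_fst [OF N atlas_F m]
            smooth_at_from_restrict_atlas [OF atlas_M openin_U fU]]
          smooth_at_snd [OF N atlas_F m]])
  then have "smooth_at (prod_atlas ?N F) (prod_atlas M F) (\<lambda>z. z) (\<psi> x)" by simp
  from smooth_at_compose [OF R NF atlas_prod \<psi> this]
  have "smooth_at ?R (prod_atlas M F) \<psi> x" .
  from smooth_at_compose [OF atlas_E R atlas_prod
      smooth_at_into_restrict_atlas [OF atlas_E openin_total xE x] this]
  show ?thesis .
qed

lemma smooth_at_triv_inv: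
  assumes z: "z \<in> U \<times> mcarrier F"
  shows "smooth_at (prod_atlas M F) E triv_inv z"
proof -
  let ?R = "restrict_atlas E total" and ?N = "restrict_atlas M U"
  have R: "atlas ?R" by (rule atlas_restrict_atlas [OF atlas_E openin_total])
  have N: "atlas ?N" by (rule atlas_restrict_atlas [OF atlas_M openin_U])
  have NF: "atlas (prod_atlas ?N F)" by (rule atlas_prod_atlas [OF N atlas_F])
  have cR: "mcarrier ?R = total" using total_subset by (auto simp: mcarrier_restrict_atlas)
  have cN: "mcarrier ?N = U" using U_subset by (auto simp: mcarrier_restrict_atlas)
  have fz: "fst z \<in> mcarrier M" "fst z \<in> U" using z U_subset by auto
  have m: "z \<in> mcarrier M \<times> mcarrier F" using fz z by (simp add: mem_Times_iff)
  have "smooth_at (prod_atlas M F) (prod_atlas ?N F) (\<lambda>z. (fst z, snd z)) z"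
    by (rule smooth_at_Pair [OF atlas_prod N atlas_F
          smooth_at_compose [OF atlas_prod atlas_M N smooth_at_fst [OF atlas_M atlas_F m]
            smooth_at_into_restrict_atlas [OF atlas_M openin_U fz]]
          smooth_at_snd [OF atlas_M atlas_F m]])
  then have into: "smooth_at (prod_atlas M F) (prod_atlas ?N F) (\<lambda>z. z) z" by simp
  have "smooth_map (prod_atlas ?N F) ?R triv_inv"
    using triv cR by (simp add: local_trivialization_def diffeomorphism_def total_def triv_inv_def)
  then have "smooth_at (prod_atlas ?N F) ?R triv_inv z"
    using smooth_map_iff_smooth_at [OF NF R] z unfolding mcarrier_prod_atlas cN by blast
  from smooth_at_compose [OF atlas_prod NF R into this]
  have \<phi>: "smooth_at (prod_atlas M F) ?R triv_inv z" .
  have t: "triv_inv z \<in> total" by (rule triv_inv_in [OF z])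
  from smooth_at_compose [OF atlas_prod R atlas_E \<phi>
      smooth_at_from_restrict_atlas [OF atlas_E openin_total _ t]] t total_subset
  show ?thesis by blast
qed

lemma smooth_at_fiber_coord:
  assumes x: "x \<in> total"
  shows "smooth_at E F (\<lambda>x. snd (\<psi> x)) x"
proof (rule smooth_at_compose [OF atlas_E atlas_prod atlas_F smooth_at_triv [OF x]])
  show "smooth_at (prod_atlas M F) F snd (\<psi> x)"
    using smooth_at_maps [OF atlas_E smooth_at_triv [OF x]]
    by (intro smooth_at_snd [OF atlas_M atlas_F]) (simp add: mcarrier_prod_atlas)
qed

lemma smooth_at_triv_inv_Pair:
  assumes A: "atlas A" and a: "smooth_at A M a x" "a x \<in> U" and b: "smooth_at A F b x"
  shows "smooth_at A E (\<lambda>x. triv_inv (a x, b x)) x"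
  by (rule smooth_at_compose [OF A atlas_prod atlas_E smooth_at_Pair [OF A atlas_M atlas_F a(1) b]])
    (use a smooth_at_maps [OF A b] in \<open>simp add: smooth_at_triv_inv\<close>)

text \<open>
  The local section through \<open>x\<close> is the one whose fibre coordinate is constant.
\<close>

lemma tangent_map_proj_surj:
  assumes x: "x \<in> total"
  shows "tangent_map E M \<pi> x ` tangent_space E x = tangent_space M (\<pi> x)"
proof -
  have xU: "\<pi> x \<in> U" "x \<in> mcarrier E" using x by (simp_all add: total_def)
  then have xM: "\<pi> x \<in> mcarrier M" using U_subset by blast
  have F: "snd (\<psi> x) \<in> mcarrier F" by (rule snd_triv_in [OF x])
  have s: "smooth_at M E (\<lambda>q. triv_inv (q, snd (\<psi> x))) (\<pi> x)"
    by (rule smooth_at_triv_inv_Pair [OF atlas_M smooth_at_id [OF atlas_M xM] xU(1)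
          smooth_at_const [OF atlas_M atlas_F xM F]])
  have "triv_inv (\<pi> x, snd (\<psi> x)) = x"
    using triv_inv_triv [OF x] fst_triv [OF x] by (metis prod.collapse)
  then show ?thesis
    using tangent_map_surj_of_local_section [OF atlas_E atlas_M smooth_at_proj [OF xU(2)] s _
        openin_U xU(1)] proj_triv_inv F by simp
qed

lemma linear_iso_model_spaces:
  assumes x: "x \<in> total"
  shows "\<exists>L :: 'm \<times> 'n \<Rightarrow> 'e. linear L \<and> bij L"
proof (rule linear_iso_of_local_diffeo [OF atlas_prod atlas_E])
  have m: "\<psi> x \<in> U \<times> mcarrier F" using bij_betwE [OF bij_triv] x by blast
  show "smooth_at (prod_atlas M F) E triv_inv (\<psi> x)" by (rule smooth_at_triv_inv [OF m])
  show "smooth_at E (prod_atlas M F) \<psi> (triv_inv (\<psi> x))"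
    by (simp add: triv_inv_triv x smooth_at_triv)
  have "openin (mtopology (prod_atlas M F)) {z \<in> mcarrier (prod_atlas M F). fst z \<in> U}"
    using openin_topspace [of "mtopology (prod_atlas M F)"]
    by (intro openin_smooth_at_preimage [OF atlas_prod atlas_M _ _ openin_U])
      (simp_all add: topspace_mtopology atlas_prod mcarrier_prod_atlas smooth_at_fst atlas_M atlas_F)
  moreover have "{z \<in> mcarrier (prod_atlas M F). fst z \<in> U} = U \<times> mcarrier F"
    using U_subset by (auto simp: mcarrier_prod_atlas)
  ultimately show "openin (mtopology (prod_atlas M F)) (U \<times> mcarrier F)" by simp
  show "triv_inv (\<psi> x) \<in> total" using x by (simp add: triv_inv_triv)
qed (use x openin_total bij_betwE [OF bij_triv] in \<open>auto simp: triv_inv_triv triv_triv_inv\<close>)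

text \<open>
  The chart \<open>m \<times> n\<close> of the product transported to \<open>E\<close> by the trivialization. It has values in
  \<open>'m \<times> 'n\<close>, hence the linear isomorphism \<open>L\<close> to the model space \<open>'e\<close> of \<open>E\<close>.
\<close>

definition adapted_chart ::
  "('m \<times> 'n \<Rightarrow> 'e) \<Rightarrow> ('b, 'm) chart \<Rightarrow> ('g, 'n) chart \<Rightarrow> ('x, 'e) chart" where
  "adapted_chart L m n =
     ({x \<in> total. \<psi> x \<in> fst m \<times> fst n}, \<lambda>x. L (snd (prod_chart m n) (\<psi> x)))"

lemma adapted_chart_in_max_atlas:
  assumes L: "linear L" "bij L" and m: "m \<in> M" and n: "n \<in> F"
  shows "adapted_chart L m n \<in> max_atlas E"
  unfolding adapted_chart_def
proof (rule chart_in_max_atlasI [OF atlas_E])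
  let ?c = "prod_chart m n" and ?K = "inv_into UNIV L"
  let ?D = "{x \<in> total. \<psi> x \<in> fst m \<times> fst n}" and ?k = "\<lambda>x. L (snd ?c (\<psi> x))"
  have cP: "?c \<in> prod_atlas M F" using m n by (rule prod_chart_in_prod_atlas)
  have cc: "chart ?c" using atlas_prod cP by (rule atlas_chart)
  have cm: "chart m" "chart n" using m n atlas_M atlas_F by (auto intro: atlas_chart)
  show "openin (mtopology E) ?D"
    using openin_smooth_at_preimage [OF atlas_E atlas_prod openin_total smooth_at_triv
        openin_chart_domain [OF atlas_prod cP]] by simp
  have inj: "inj_on \<psi> total" using bij_triv by (simp add: bij_betw_def)
  show injk: "inj_on ?k ?D"
  proof (rule inj_onI)
    fix x y assume xy: "x \<in> ?D" "y \<in> ?D" "?k x = ?k y"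
    then have "snd ?c (\<psi> x) = snd ?c (\<psi> y)" using L(2) by (meson bij_is_inj injD)
    then have "\<psi> x = \<psi> y"
      using xy inj_onD [of "snd ?c" "fst ?c"] cc unfolding chart_def by simp
    then show "x = y" using xy inj by (auto dest: inj_onD)
  qed
  have linv: "linear ?K" 
  proof -
    obtain l where l: "linear l" "l \<circ> L = id"
      using linear_injective_left_inverse [OF L(1) bij_is_inj [OF L(2)]] by blast
    have "l x = ?K x" for x
    proof -
      obtain y where "x = L y" using bij_is_surj [OF L(2)] by (metis surjD)
      then show ?thesis using l(2) bij_is_inj [OF L(2)] by (metis comp_apply id_apply inv_f_f)
    qed
    then have "l = ?K" by (rule ext)
    with l show ?thesis by simp
  qed
  show opk: "open (?k ` ?D)"
  proof -
    \<comment> \<open>The domain of \<open>m\<close> may reach beyond \<open>U\<close>, where the trivialization is not defined.\<close>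
    have "\<psi> ` ?D = (fst m \<inter> U) \<times> fst n"
    proof -
      have "fst n \<subseteq> mcarrier F" using n by (auto simp: mcarrier_def)
      moreover have "\<psi> ` ?D = \<psi> ` total \<inter> fst m \<times> fst n"
      proof (intro equalityI subsetI)
        fix z assume z: "z \<in> \<psi> ` total \<inter> fst m \<times> fst n"
        then obtain x where "x \<in> total" "z = \<psi> x" by blast
        with z show "z \<in> \<psi> ` ?D" by (intro image_eqI [of _ \<psi> x]) simp_all
      next
        fix z assume "z \<in> \<psi> ` ?D"
        then show "z \<in> \<psi> ` total \<inter> fst m \<times> fst n" by blast
      qed
      moreover have "\<psi> ` total = U \<times> mcarrier F" using bij_triv by (simp add: bij_betw_def)
      ultimately show ?thesis by (simp add: Times_Int_Times Int_commute Int_absorb1)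
    qed
    moreover have "?k ` ?D = L ` (snd ?c ` (\<psi> ` ?D))" by (simp only: image_image)
    ultimately have "?k ` ?D = L ` (snd ?c ` ((fst m \<inter> U) \<times> fst n))" by (simp only:)
    also have "\<dots> = ?K -` (snd m ` (fst m \<inter> U) \<times> snd n ` fst n)"
      unfolding prod_chart_image using L(2) by (simp add: bij_vimage_eq_inv_image bij_imp_bij_inv inv_inv_eq)
    also have "open \<dots>"
    proof (rule open_vimage)
      show "open (snd m ` (fst m \<inter> U) \<times> snd n ` fst n)"
        using openin_mtopology_coord [OF atlas_M openin_U m] cm by (simp add: chart_def open_Times)
      show "continuous_on UNIV ?K"
        by (rule linear_continuous_on [OF linear_imp_bounded_linear [OF linv]])
    qed
    finally show ?thesis .
  qed
  show "smooth_at E model_atlas ?k x" if x: "x \<in> ?D" for x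
  proof (rule smooth_at_compose [OF atlas_E atlas_model_atlas atlas_model_atlas _ smooth_at_linear [OF L(1)]])
    have "smooth_at (prod_atlas M F) model_atlas (snd ?c) (\<psi> x)"
      using smooth_at_coord [OF atlas_prod cP] x by simp
    then show "smooth_at E model_atlas (\<lambda>x. snd ?c (\<psi> x)) x"
      using smooth_at_compose [OF atlas_E atlas_prod atlas_model_atlas smooth_at_triv] x by blast
  qed
  show "smooth_at model_atlas E (inv_into ?D ?k) (?k x)" if x: "x \<in> ?D" for x
  proof (rule smooth_at_cong [OF atlas_model_atlas])
    have invL: "?K (L v) = v" for v using L(2) by (simp add: bij_is_inj)
    have ic: "chart_inv ?c (snd ?c (\<psi> y)) = \<psi> y" if "y \<in> ?D" for y
      using that by (intro chart_inv_coord [OF cc]) simp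
    have s1: "smooth_at model_atlas (prod_atlas M F) (\<lambda>v. chart_inv ?c (?K v)) (?k x)"
    proof (rule smooth_at_compose [OF atlas_model_atlas atlas_model_atlas atlas_prod smooth_at_linear [OF linv]])
      show "smooth_at model_atlas (prod_atlas M F) (chart_inv ?c) (?K (?k x))"
        unfolding invL using x by (intro smooth_at_chart_inv [OF atlas_prod cP] imageI) simp
    qed
    have "\<psi> x \<in> U \<times> mcarrier F" using bij_betwE [OF bij_triv] x by blast
    then have s2: "smooth_at (prod_atlas M F) E triv_inv (chart_inv ?c (?K (?k x)))"
      unfolding invL ic [OF x] by (rule smooth_at_triv_inv)
    \<comment> \<open>The inverse chart undoes \<open>L\<close>, then \<open>m \<times> n\<close>, then the trivialization.\<close>
    show "smooth_at model_atlas E (\<lambda>v. triv_inv (chart_inv ?c (?K v))) (?k x)"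
      by (rule smooth_at_compose [OF atlas_model_atlas atlas_prod atlas_E s1 s2])
    show "openin (mtopology model_atlas) (?k ` ?D)" using opk by (simp only: openin_model_atlas)
    show "?k x \<in> ?k ` ?D" using x by (rule imageI)
    fix v assume "v \<in> ?k ` ?D"
    then obtain y where y: "v = ?k y" "y \<in> ?D" by (rule imageE)
    have "triv_inv (chart_inv ?c (?K v)) = y"
      unfolding y(1) invL ic [OF y(2)] using y(2) by (simp add: triv_inv_triv)
    moreover have "inv_into ?D ?k v = y" unfolding y(1) by (rule inv_into_f_f [OF injk y(2)])
    ultimately show "triv_inv (chart_inv ?c (?K v)) = inv_into ?D ?k v" by simp
  qed
qed

end

section \<open>Fibrewise group structures in a trivialization\<close>

text \<open>
  Because \<open>\<psi>\<close> is multiplicative on each fibre, the structure maps of the groupoid have coordinate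
  expressions in terms of those of the Lie group \<open>G\<close>.
\<close>

locale group_trivialization = trivialization E \<pi> M F U \<psi>
  for E :: "('x, 'e::model_space) atlas" and \<pi> :: "'x \<Rightarrow> 'b"
    and M :: "('b, 'm::model_space) atlas" and F :: "('g, 'n::model_space) atlas"
    and U :: "'b set" and \<psi> :: "'x \<Rightarrow> 'b \<times> 'g" +
  fixes G :: "'g monoid" and grp :: "'b \<Rightarrow> 'x monoid"
  assumes lie_group_F: "lie_group F G"
    and group_fiber: "\<And>p. p \<in> U \<Longrightarrow> group (grp p)"
    and carrier_fiber: "\<And>p. p \<in> U \<Longrightarrow> carrier (grp p) = fiber E \<pi> p"
    and hom_fiber: "\<And>p. p \<in> U \<Longrightarrow> (\<lambda>x. snd (\<psi> x)) \<in> hom (grp p) G"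
begin

lemma group_G: "group G" and carrier_G: "carrier G = mcarrier F"
  using lie_group_F by (simp_all add: lie_group_def)

lemma group_hom_fiber: "p \<in> U \<Longrightarrow> group_hom (grp p) G (\<lambda>x. snd (\<psi> x))"
  by (simp add: group_hom_def group_hom_axioms_def group_fiber group_G hom_fiber)

lemma fiber_subset_total: "p \<in> U \<Longrightarrow> x \<in> carrier (grp p) \<Longrightarrow> x \<in> total \<and> \<pi> x = p"
  by (simp add: carrier_fiber fiber_def total_def)

lemma in_own_fiber: "x \<in> total \<Longrightarrow> \<pi> x \<in> U \<and> x \<in> carrier (grp (\<pi> x))"
  by (simp add: carrier_fiber fiber_def total_def)

text \<open>
  A point of a fibre is determined by its fibre coordinate, on which the homomorphism property
  gives control. This yields the coordinate expressions of unit, inverse and product below.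
\<close>

lemma fiber_eq_triv_inv: "p \<in> U \<Longrightarrow> x \<in> carrier (grp p) \<Longrightarrow> x = triv_inv (p, snd (\<psi> x))"
  using fiber_subset_total [of p x] triv_inv_triv [of x] fst_triv [of x] by (metis prod.collapse)

lemma unit_eq: "p \<in> U \<Longrightarrow> \<one>\<^bsub>grp p\<^esub> = triv_inv (p, \<one>\<^bsub>G\<^esub>)"
  using fiber_eq_triv_inv [of p "\<one>\<^bsub>grp p\<^esub>"] group_hom.hom_one [OF group_hom_fiber, of p]
    group.is_monoid [OF group_fiber, of p] by (simp add: monoid.one_closed)

lemma inverse_eq:
  assumes x: "x \<in> total"
  shows "inv\<^bsub>grp (\<pi> x)\<^esub> x = triv_inv (\<pi> x, inv\<^bsub>G\<^esub> (snd (\<psi> x)))"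
  using in_own_fiber [OF x] fiber_eq_triv_inv [of "\<pi> x" "inv\<^bsub>grp (\<pi> x)\<^esub> x"]
    group_hom.hom_inv [OF group_hom_fiber, of "\<pi> x" x] group.inv_closed [OF group_fiber, of "\<pi> x" x]
  by simp

lemma mult_eq:
  assumes x: "x \<in> total" and y: "y \<in> total" "\<pi> x = \<pi> y"
  shows "x \<otimes>\<^bsub>grp (\<pi> x)\<^esub> y = triv_inv (\<pi> x, snd (\<psi> x) \<otimes>\<^bsub>G\<^esub> snd (\<psi> y))"
proof -
  have m: "\<pi> x \<in> U" "x \<in> carrier (grp (\<pi> x))" "y \<in> carrier (grp (\<pi> x))"
    using in_own_fiber [OF x] in_own_fiber [OF y(1)] y(2) by simp_all
  then have "x \<otimes>\<^bsub>grp (\<pi> x)\<^esub> y \<in> carrier (grp (\<pi> x))"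
    using group.is_monoid [OF group_fiber] by (simp add: monoid.m_closed)
  from fiber_eq_triv_inv [OF m(1) this] show ?thesis
    using hom_mult [OF hom_fiber [OF m(1)] m(2,3)] by simp
qed

lemma smooth_at_unit:
  assumes p: "p \<in> U"
  shows "smooth_at M E (\<lambda>q. \<one>\<^bsub>grp q\<^esub>) p"
proof (rule smooth_at_cong [OF atlas_M _ openin_U p])
  have pM: "p \<in> mcarrier M" using p U_subset by blast
  have "\<one>\<^bsub>G\<^esub> \<in> mcarrier F"
    using group.is_monoid [OF group_G] carrier_G by (metis monoid.one_closed)
  then show "smooth_at M E (\<lambda>q. triv_inv (q, \<one>\<^bsub>G\<^esub>)) p"
    by (intro smooth_at_triv_inv_Pair atlas_M atlas_F smooth_at_id smooth_at_const pM p)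
qed (simp add: unit_eq)

lemma smooth_at_inverse:
  assumes x: "x \<in> total"
  shows "smooth_at E E (\<lambda>x. inv\<^bsub>grp (\<pi> x)\<^esub> x) x"
proof (rule smooth_at_cong [OF atlas_E _ openin_total x])
  have xE: "x \<in> mcarrier E" "\<pi> x \<in> U" using x by (simp_all add: total_def)
  have "smooth_map F F (\<lambda>h. inv\<^bsub>G\<^esub> h)" using lie_group_F by (simp add: lie_group_def)
  then have "smooth_at F F (\<lambda>h. inv\<^bsub>G\<^esub> h) (snd (\<psi> x))"
    using smooth_map_iff_smooth_at [OF atlas_F atlas_F] snd_triv_in [OF x] by blast
  from smooth_at_compose [OF atlas_E atlas_F atlas_F smooth_at_fiber_coord [OF x] this]
  show "smooth_at E E (\<lambda>x. triv_inv (\<pi> x, inv\<^bsub>G\<^esub> (snd (\<psi> x)))) x"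
    by (rule smooth_at_triv_inv_Pair [OF atlas_E smooth_at_proj [OF xE(1)] xE(2)])
qed (simp add: inverse_eq)

text \<open>
  The multiplication is defined on composable pairs only, but its expression in the trivialization
  makes sense for all pairs over \<open>U\<close>. It is a smooth map on an open subset of \<open>E \<times> E\<close>, of which the
  multiplication is the restriction to the fibre product.
\<close>

lemma smooth_at_mult:
  assumes z: "fst z \<in> total" "snd z \<in> total"
  shows "smooth_at (prod_atlas E E) E
    (\<lambda>z. triv_inv (\<pi> (fst z), snd (\<psi> (fst z)) \<otimes>\<^bsub>G\<^esub> snd (\<psi> (snd z)))) z"
proof -
  have EE: "atlas (prod_atlas E E)" and FF: "atlas (prod_atlas F F)"
    by (simp_all add: atlas_prod_atlas atlas_E atlas_F)
  have zE: "fst z \<in> mcarrier E" "\<pi> (fst z) \<in> U" using z by (simp_all add: total_def)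
  have zEE: "z \<in> mcarrier E \<times> mcarrier E" using z by (simp add: total_def mem_Times_iff)
  note f = smooth_at_fst [OF atlas_E atlas_E zEE] and s = smooth_at_snd [OF atlas_E atlas_E zEE]
  have pr: "smooth_at (prod_atlas E E) M (\<lambda>z. \<pi> (fst z)) z"
    by (rule smooth_at_compose [OF EE atlas_E atlas_M f smooth_at_proj [OF zE(1)]])
  have "smooth_map (prod_atlas F F) F (\<lambda>(x, y). x \<otimes>\<^bsub>G\<^esub> y)"
    using lie_group_F by (simp add: lie_group_def)
  then have mult: "smooth_at (prod_atlas F F) F (\<lambda>(x, y). x \<otimes>\<^bsub>G\<^esub> y)
      (snd (\<psi> (fst z)), snd (\<psi> (snd z)))"
    using smooth_map_iff_smooth_at [OF FF atlas_F, of "\<lambda>(x, y). x \<otimes>\<^bsub>G\<^esub> y"]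
      snd_triv_in [OF z(1)] snd_triv_in [OF z(2)]
    unfolding mcarrier_prod_atlas by blast
  have pair: "smooth_at (prod_atlas E E) (prod_atlas F F) (\<lambda>z. (snd (\<psi> (fst z)), snd (\<psi> (snd z)))) z"
    by (rule smooth_at_Pair [OF EE atlas_F atlas_F
          smooth_at_compose [OF EE atlas_E atlas_F f smooth_at_fiber_coord [OF z(1)]]
          smooth_at_compose [OF EE atlas_E atlas_F s smooth_at_fiber_coord [OF z(2)]]])
  have "smooth_at (prod_atlas E E) F (\<lambda>z. snd (\<psi> (fst z)) \<otimes>\<^bsub>G\<^esub> snd (\<psi> (snd z))) z"
    using smooth_at_compose [OF EE FF atlas_F pair mult] by simp
  from smooth_at_triv_inv_Pair [OF EE pr zE(2) this] show ?thesis .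
qed

end

section \<open>The fibre product\<close>

definition fiber_product :: "('x, 'e) atlas \<Rightarrow> ('x \<Rightarrow> 'b) \<Rightarrow> ('x \<times> 'x) set" where
  "fiber_product E \<pi> = {(x, y). x \<in> mcarrier E \<and> y \<in> mcarrier E \<and> \<pi> x = \<pi> y}"

context trivialization
begin

text \<open>
  Both factors use the same chart \<open>m\<close> of the base, so \<open>(x, y)\<close> is composable if and only if the
  base coordinates of \<open>x\<close> and \<open>y\<close> agree, which is a linear condition with solutions
  \<open>(a, b)\<close>, \<open>(a, b')\<close>. The fibre charts \<open>n\<close> and \<open>n'\<close> may differ, since \<open>x\<close> and \<open>y\<close> need not be
  close to each other in the fibre.
\<close>

lemma slice_chart_fiber_product:
  assumes L: "linear L" "bij L" and m: "m \<in> M" and n: "n \<in> F" "n' \<in> F"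
  shows "slice_chart (prod_atlas E E) (fiber_product E \<pi>)
    (prod_chart (adapted_chart L m n) (adapted_chart L m n'))
    (\<lambda>(a, b, b'). (L (a, b), L (a, b')))"
  (is "slice_chart _ ?S ?c ?j")
  unfolding slice_chart_def
proof (intro conjI)
  show "?c \<in> max_atlas (prod_atlas E E)"
    by (intro max_atlas_prod atlas_E adapted_chart_in_max_atlas L m n)
  have inj: "L u = L v \<longleftrightarrow> u = v" for u v using L(2) by (meson bij_is_inj injD)
  show "linear ?j"
  proof (rule linearI)
    fix u v :: "'m \<times> 'n \<times> 'n" and r :: real
    obtain a b b' where u: "u = (a, b, b')" by (cases u)
    obtain d e e' where v: "v = (d, e, e')" by (cases v)
    show "?j (u + v) = ?j u + ?j v"
      using linear_add [OF L(1), of "(a, b)" "(d, e)"] linear_add [OF L(1), of "(a, b')" "(d, e')"]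
      by (simp add: u v)
    show "?j (r *\<^sub>R u) = r *\<^sub>R ?j u"
      using linear_scale [OF L(1), of r "(a, b)"] linear_scale [OF L(1), of r "(a, b')"]
      by (simp add: u)
  qed
  show "inj ?j" by (rule injI) (auto simp: inj)
  show "snd ?c ` (fst ?c \<inter> ?S) = snd ?c ` fst ?c \<inter> range ?j"
  proof (intro equalityI subsetI IntI)
    fix w assume "w \<in> snd ?c ` (fst ?c \<inter> ?S)"
    then obtain z where z: "z \<in> fst ?c" "z \<in> ?S" "w = snd ?c z" by blast
    then show "w \<in> snd ?c ` fst ?c" by blast
    obtain x y where xy: "z = (x, y)" by (cases z)
    have t: "x \<in> total" "y \<in> total" "\<pi> x = \<pi> y"
      using z(1,2) by (auto simp: xy adapted_chart_def fiber_product_def)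
    then have "fst (\<psi> x) = fst (\<psi> y)" by (simp add: fst_triv)
    then have "w = ?j (snd m (fst (\<psi> x)), snd n (snd (\<psi> x)), snd n' (snd (\<psi> y)))"
      by (simp add: z(3) xy adapted_chart_def)
    then show "w \<in> range ?j" by blast
  next
    fix w assume w: "w \<in> snd ?c ` fst ?c \<inter> range ?j"
    then obtain z where z: "z \<in> fst ?c" "w = snd ?c z" by blast
    obtain x y where xy: "z = (x, y)" by (cases z)
    obtain a b b' where j: "w = (L (a, b), L (a, b'))" using w by auto
    have t: "x \<in> total" "y \<in> total" "fst (\<psi> x) \<in> fst m" "fst (\<psi> y) \<in> fst m"
      using z(1) by (auto simp: xy adapted_chart_def)
    have "snd m (fst (\<psi> x)) = snd m (fst (\<psi> y))"
      using z(2) j by (auto simp: xy adapted_chart_def inj)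
    then have "fst (\<psi> x) = fst (\<psi> y)"
      using t atlas_chart [OF atlas_M m] by (simp add: chart_def inj_on_def)
    then have "\<pi> x = \<pi> y" using t by (simp add: fst_triv)
    then have "z \<in> ?S" using t total_subset by (auto simp: xy fiber_product_def)
    with z show "w \<in> snd ?c ` (fst ?c \<inter> ?S)" by blast
  qed
qed

lemma slice_chart_fiber_product_at:
  assumes x: "x \<in> total" and y: "y \<in> total" "\<pi> x = \<pi> y"
  shows "\<exists>c. \<exists>j :: 'm \<times> 'n \<times> 'n \<Rightarrow> 'e \<times> 'e.
    slice_chart (prod_atlas E E) (fiber_product E \<pi>) c j \<and> (x, y) \<in> fst c"
proof -
  obtain L :: "'m \<times> 'n \<Rightarrow> 'e" where L: "linear L" "bij L"
    using linear_iso_model_spaces [OF x] by blast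
  have "\<pi> x \<in> mcarrier M" using x U_subset by (auto simp: total_def)
  then obtain m where m: "m \<in> M" "\<pi> x \<in> fst m" by (rule mcarrier_chartE)
  obtain n where n: "n \<in> F" "snd (\<psi> x) \<in> fst n" using snd_triv_in [OF x] by (rule mcarrier_chartE)
  obtain n' where n': "n' \<in> F" "snd (\<psi> y) \<in> fst n'" using snd_triv_in [OF y(1)] by (rule mcarrier_chartE)
  have "(x, y) \<in> fst (prod_chart (adapted_chart L m n) (adapted_chart L m n'))"
    using x y m n n' fst_triv by (simp add: adapted_chart_def mem_Times_iff)
  with slice_chart_fiber_product [OF L m(1) n(1) n'(1)] show ?thesis by blast
qed

end

text \<open>
  Restrict the smooth map of the lemma \<open>smooth_at_mult\<close> along the inclusion of the fibre product.
  It agrees with the multiplication over \<open>U\<close>, which is an open condition on the first factor.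
\<close>

lemma (in group_trivialization) smooth_at_fiber_product_mult:
  fixes z :: "'x \<times> 'x"
  defines "P \<equiv> submanifold_atlas (prod_atlas E E) (fiber_product E \<pi>) ::
    ('x \<times> 'x, 'k::model_space) atlas"
  assumes z: "z \<in> mcarrier P" and t: "fst z \<in> total"
  shows "smooth_at P E (\<lambda>(g, h). g \<otimes>\<^bsub>grp (\<pi> g)\<^esub> h) z"
proof (rule smooth_at_cong)
  have EE: "atlas (prod_atlas E E)" by (simp add: atlas_prod_atlas atlas_E)
  show P: "atlas P" unfolding P_def by (rule atlas_submanifold_atlas [OF EE])
  have inc: "smooth_at P (prod_atlas E E) (\<lambda>w. w) w" if "w \<in> mcarrier P" for w
    using that unfolding P_def by (rule smooth_at_submanifold_inclusion [OF EE])
  have sub: "mcarrier P \<subseteq> fiber_product E \<pi>"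
    unfolding P_def by (rule mcarrier_submanifold_atlas)
  have tot: "snd w \<in> total \<and> \<pi> (fst w) = \<pi> (snd w)" if "w \<in> mcarrier P" "fst w \<in> total" for w
    using that subsetD [OF sub, of w] by (cases w) (auto simp: fiber_product_def total_def)
  have "smooth_at (prod_atlas E E) E
      (\<lambda>z. triv_inv (\<pi> (fst z), snd (\<psi> (fst z)) \<otimes>\<^bsub>G\<^esub> snd (\<psi> (snd z)))) z"
    using tot [OF z t] t by (intro smooth_at_mult) simp_all
  from smooth_at_compose [OF P EE atlas_E inc [OF z] this]
  show "smooth_at P E (\<lambda>z. triv_inv (\<pi> (fst z), snd (\<psi> (fst z)) \<otimes>\<^bsub>G\<^esub> snd (\<psi> (snd z)))) z" .
  have op: "openin (mtopology P) (mcarrier P)"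
    using openin_topspace [of "mtopology P"] by (simp add: topspace_mtopology P)
  show "openin (mtopology P) {w \<in> mcarrier P. fst w \<in> total}"
  proof (rule openin_smooth_at_preimage [OF P atlas_E op _ openin_total])
    fix w assume w: "w \<in> mcarrier P"
    then have "w \<in> mcarrier E \<times> mcarrier E" using sub by (auto simp: fiber_product_def)
    from smooth_at_compose [OF P EE atlas_E inc [OF w] smooth_at_fst [OF atlas_E atlas_E this]]
    show "smooth_at P E fst w" .
  qed
  show "z \<in> {w \<in> mcarrier P. fst w \<in> total}" using z t by simp
  fix w assume "w \<in> {w \<in> mcarrier P. fst w \<in> total}"
  then have w: "w \<in> mcarrier P" "fst w \<in> total" by simp_all
  show "triv_inv (\<pi> (fst w), snd (\<psi> (fst w)) \<otimes>\<^bsub>G\<^esub> snd (\<psi> (snd w))) =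
      (case w of (g, h) \<Rightarrow> g \<otimes>\<^bsub>grp (\<pi> g)\<^esub> h)"
    using mult_eq [OF w(2)] tot [OF w] by (simp add: case_prod_beta)
qed

section \<open>The canonical groupoid of a symplectic Lie group bundle\<close>

lemma group_trivialization_of_bundle:
  fixes GA :: "('g, 'n::model_space) atlas" and E :: "('x, 'e::model_space) atlas"
    and M :: "('b, 'm::model_space) atlas"
  assumes B: "symplectic_lie_group_bundle GA G \<omega> E \<pi> M grp \<omega>'" and p: "p \<in> mcarrier M"
  shows "\<exists>U \<psi>. p \<in> U \<and> group_trivialization E \<pi> M GA U \<psi> G grp"
proof -
  obtain T where T: "(\<Union>(U, \<psi>)\<in>T. U) = mcarrier M"
    and triv: "\<forall>(U, \<psi>)\<in>T. local_trivialization E \<pi> M GA U \<psi> \<and>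
      (\<forall>p\<in>U. symplectic_lie_group_iso
        (submanifold_atlas E (fiber E \<pi> p) :: ('x, 'n) atlas) (grp p)
        (restrict_form2 E (fiber E \<pi> p) \<omega>') GA G \<omega> (\<lambda>x. snd (\<psi> x)))"
    using B unfolding symplectic_lie_group_bundle_def by (elim conjE exE) (rule that; assumption)
  have parts: "lie_group GA G" "atlas E" "atlas M" "atlas GA" "smooth_map E M \<pi>"
    using B by (simp_all add: symplectic_lie_group_bundle_def symplectic_lie_group_def
        smooth_fiber_bundle_def smooth_manifold_def)
  have fib: "group (grp q)" "carrier (grp q) = fiber E \<pi> q" if "q \<in> mcarrier M" for q
    using B that by (simp_all add: symplectic_lie_group_bundle_def lie_group_def)
  obtain U \<psi> where U: "(U, \<psi>) \<in> T" "p \<in> U" using T p by blast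
  have sub: "U \<subseteq> mcarrier M" using T U by blast
  have "(\<lambda>x. snd (\<psi> x)) \<in> hom (grp q) G" if "q \<in> U" for q
    using triv U that by (auto simp: symplectic_lie_group_iso_def iso_def)
  moreover have "local_trivialization E \<pi> M GA U \<psi>" using triv U by blast
  ultimately have "group_trivialization E \<pi> M GA U \<psi> G grp"
    using parts fib sub
    by (intro group_trivialization.intro trivialization.intro group_trivialization_axioms.intro) auto
  with U show ?thesis by blast
qed

text \<open>
  A groupoid in which source and target coincide is the same as a family of groups.
\<close>

lemma groupoid_of_fiber_groups:
  assumes proj: "\<pi> ` mcarrier E = mcarrier M"
    and grp: "\<And>p. p \<in> mcarrier M \<Longrightarrow> group (grp p)"
    and carr: "\<And>p. p \<in> mcarrier M \<Longrightarrow> carrier (grp p) = fiber E \<pi> p"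
  shows "groupoid (canonical_groupoid E \<pi> M grp)"
proof -
  have base: "\<pi> g \<in> mcarrier M" if "g \<in> mcarrier E" for g using that proj by blast
  have own: "g \<in> carrier (grp (\<pi> g))" if "g \<in> mcarrier E" for g
    using that by (simp add: carr base fiber_def)
  have fibD: "g \<in> mcarrier E" "\<pi> g = p" if "p \<in> mcarrier M" "g \<in> carrier (grp p)" for g p
    using that by (simp_all add: carr fiber_def)
  have own': "h \<in> carrier (grp (\<pi> g))" if "h \<in> mcarrier E" "\<pi> g = \<pi> h" for g h
    using own [OF that(1)] that(2) by simp
  have one: "\<one>\<^bsub>grp p\<^esub> \<in> carrier (grp p)" if "p \<in> mcarrier M" for p
    using group.is_monoid [OF grp [OF that]] by (rule monoid.one_closed)
  have mult: "g \<otimes>\<^bsub>grp (\<pi> g)\<^esub> h \<in> carrier (grp (\<pi> g))"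
    if "g \<in> mcarrier E" "h \<in> mcarrier E" "\<pi> g = \<pi> h" for g h
    by (rule monoid.m_closed [OF group.is_monoid [OF grp [OF base [OF that(1)]]]
          own [OF that(1)] own' [OF that(2,3)]])
  have inver: "inv\<^bsub>grp (\<pi> g)\<^esub> g \<in> carrier (grp (\<pi> g))" if "g \<in> mcarrier E" for g
    by (rule group.inv_closed [OF grp [OF base [OF that]] own [OF that]])
  note multD = fibD [OF base mult] and inverD = fibD [OF base inver] and oneD = fibD [OF _ one]
  show ?thesis
    unfolding groupoid_def
  proof (intro conjI)
    let ?\<Gamma> = "canonical_groupoid E \<pi> M grp"
    show "\<forall>(g, h)\<in>composable ?\<Gamma>. mul ?\<Gamma> g h \<in> mcarrier (arr ?\<Gamma>) \<and>
        src ?\<Gamma> (mul ?\<Gamma> g h) = src ?\<Gamma> h \<and> tgt ?\<Gamma> (mul ?\<Gamma> g h) = tgt ?\<Gamma> g"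
      using multD by (auto simp: canonical_groupoid_def composable_def)
    show "\<forall>g h k. (g, h) \<in> composable ?\<Gamma> \<longrightarrow> (h, k) \<in> composable ?\<Gamma> \<longrightarrow>
        mul ?\<Gamma> (mul ?\<Gamma> g h) k = mul ?\<Gamma> g (mul ?\<Gamma> h k)"
    proof (intro allI impI)
      fix g h k assume "(g, h) \<in> composable ?\<Gamma>" "(h, k) \<in> composable ?\<Gamma>"
      then have m: "g \<in> mcarrier E" "h \<in> mcarrier E" "k \<in> mcarrier E" and e: "\<pi> g = \<pi> k" "\<pi> h = \<pi> k"
        by (auto simp: canonical_groupoid_def composable_def)
      have "g \<otimes>\<^bsub>grp (\<pi> k)\<^esub> h \<otimes>\<^bsub>grp (\<pi> k)\<^esub> k = g \<otimes>\<^bsub>grp (\<pi> k)\<^esub> (h \<otimes>\<^bsub>grp (\<pi> k)\<^esub> k)"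
        using own [OF m(1)] own [OF m(2)] own [OF m(3)] e
        by (intro monoid.m_assoc [OF group.is_monoid [OF grp [OF base [OF m(3)]]]]) simp_all
      then show "mul ?\<Gamma> (mul ?\<Gamma> g h) k = mul ?\<Gamma> g (mul ?\<Gamma> h k)"
        using multD(2) [OF m(1) m(1) m(2)] e by (simp add: canonical_groupoid_def)
    qed
    show "\<forall>g\<in>mcarrier (arr ?\<Gamma>).
        mul ?\<Gamma> (idt ?\<Gamma> (tgt ?\<Gamma> g)) g = g \<and> mul ?\<Gamma> g (idt ?\<Gamma> (src ?\<Gamma> g)) = g"
      using grp base own oneD(2)
      by (simp add: canonical_groupoid_def group.is_monoid monoid.l_one monoid.r_one)
    show "\<forall>g\<in>mcarrier (arr ?\<Gamma>). ivs ?\<Gamma> g \<in> mcarrier (arr ?\<Gamma>) \<and>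
        src ?\<Gamma> (ivs ?\<Gamma> g) = tgt ?\<Gamma> g \<and> tgt ?\<Gamma> (ivs ?\<Gamma> g) = src ?\<Gamma> g \<and>
        mul ?\<Gamma> g (ivs ?\<Gamma> g) = idt ?\<Gamma> (tgt ?\<Gamma> g) \<and> mul ?\<Gamma> (ivs ?\<Gamma> g) g = idt ?\<Gamma> (src ?\<Gamma> g)"
      using grp base own inverD
      by (simp add: canonical_groupoid_def group.r_inv group.l_inv)
  qed (use base oneD in \<open>auto simp: canonical_groupoid_def\<close>)
qed

lemma lie_groupoid_of_bundle:
  fixes GA :: "('g, 'n::model_space) atlas" and E :: "('x, 'e::model_space) atlas"
    and M :: "('b, 'm::model_space) atlas"
  assumes B: "symplectic_lie_group_bundle GA G \<omega> E \<pi> M grp \<omega>'"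
  shows "lie_groupoid TYPE('n) (canonical_groupoid E \<pi> M grp)"
proof -
  let ?\<Gamma> = "canonical_groupoid E \<pi> M grp"
  let ?P = "submanifold_atlas (prod_atlas E E) (fiber_product E \<pi>) :: ('x \<times> 'x, 'm \<times> 'n \<times> 'n) atlas"
  have mf: "smooth_manifold E" "smooth_manifold M" "smooth_map E M \<pi>"
    and proj: "\<pi> ` mcarrier E = mcarrier M"
    using B by (simp_all add: symplectic_lie_group_bundle_def smooth_fiber_bundle_def)
  have E: "atlas E" and M: "atlas M" using mf by (simp_all add: smooth_manifold_def)
  have EE: "atlas (prod_atlas E E)" by (rule atlas_prod_atlas [OF E E])
  have P: "atlas ?P" by (rule atlas_submanifold_atlas [OF EE])
  have comp: "composable ?\<Gamma> = fiber_product E \<pi>"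
    by (simp add: composable_def canonical_groupoid_def fiber_product_def)
  have grpd: "groupoid ?\<Gamma>"
    using B by (intro groupoid_of_fiber_groups proj)
      (simp_all add: symplectic_lie_group_bundle_def lie_group_def)
  have triv: "\<exists>U \<psi>. group_trivialization E \<pi> M GA U \<psi> G grp \<and> x \<in> trivialization.total E \<pi> U"
    if x: "x \<in> mcarrier E" for x
  proof -
    have "\<pi> x \<in> mcarrier M" using proj x by blast
    then obtain U \<psi> where U: "\<pi> x \<in> U" "group_trivialization E \<pi> M GA U \<psi> G grp"
      using group_trivialization_of_bundle [OF B] by blast
    then interpret group_trivialization E \<pi> M GA U \<psi> G grp by blast
    have "x \<in> total" using x U by (simp add: total_def)
    with U show ?thesis by blast
  qed
  have "tangent_map E M \<pi> x ` tangent_space E x = tangent_space M (\<pi> x)" if x: "x \<in> mcarrier E" for x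
  proof -
    obtain U \<psi> where U: "group_trivialization E \<pi> M GA U \<psi> G grp" "x \<in> trivialization.total E \<pi> U"
      using triv [OF x] by blast
    then interpret group_trivialization E \<pi> M GA U \<psi> G grp by blast
    show ?thesis using U(2) by (rule tangent_map_proj_surj)
  qed
  with mf have subm: "submersion E M \<pi>" by (simp add: submersion_def)
  have unit: "smooth_map M E (\<lambda>p. \<one>\<^bsub>grp p\<^esub>)"
    unfolding smooth_map_iff_smooth_at [OF M E]
  proof
    fix p assume "p \<in> mcarrier M"
    then obtain U \<psi> where U: "p \<in> U" "group_trivialization E \<pi> M GA U \<psi> G grp"
      using group_trivialization_of_bundle [OF B] by blast
    then interpret group_trivialization E \<pi> M GA U \<psi> G grp by blast
    show "smooth_at M E (\<lambda>p. \<one>\<^bsub>grp p\<^esub>) p" using U(1) by (rule smooth_at_unit)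
  qed
  have inver: "smooth_map E E (\<lambda>g. inv\<^bsub>grp (\<pi> g)\<^esub> g)"
    unfolding smooth_map_iff_smooth_at [OF E E]
  proof
    fix x assume "x \<in> mcarrier E"
    then obtain U \<psi> where U: "group_trivialization E \<pi> M GA U \<psi> G grp" "x \<in> trivialization.total E \<pi> U"
      using triv by blast
    then interpret group_trivialization E \<pi> M GA U \<psi> G grp by blast
    show "smooth_at E E (\<lambda>g. inv\<^bsub>grp (\<pi> g)\<^esub> g) x" using U(2) by (rule smooth_at_inverse)
  qed
  have emb: "embedded_submanifold TYPE('m \<times> 'n \<times> 'n) (prod_atlas E E) (fiber_product E \<pi>)"
    unfolding embedded_submanifold_def
  proof (intro conjI ballI)
    show "fiber_product E \<pi> \<subseteq> mcarrier (prod_atlas E E)"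
      by (auto simp: fiber_product_def mcarrier_prod_atlas)
    fix z assume z: "z \<in> fiber_product E \<pi>"
    obtain x y where xy: "z = (x, y)" by (cases z)
    have x: "x \<in> mcarrier E" "y \<in> mcarrier E" "\<pi> x = \<pi> y" using z by (simp_all add: xy fiber_product_def)
    obtain U \<psi> where U: "group_trivialization E \<pi> M GA U \<psi> G grp" "x \<in> trivialization.total E \<pi> U"
      using triv [OF x(1)] by blast
    then interpret group_trivialization E \<pi> M GA U \<psi> G grp by blast
    have y: "y \<in> total" using U(2) x by (simp add: total_def)
    show "\<exists>c. \<exists>j :: 'm \<times> 'n \<times> 'n \<Rightarrow> 'e \<times> 'e.
        slice_chart (prod_atlas E E) (fiber_product E \<pi>) c j \<and> z \<in> fst c"
      unfolding xy by (rule slice_chart_fiber_product_at [OF U(2) y x(3)])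
  qed
  have mult: "smooth_map ?P E (\<lambda>(g, h). g \<otimes>\<^bsub>grp (\<pi> g)\<^esub> h)"
    unfolding smooth_map_iff_smooth_at [OF P E]
  proof
    fix z assume z: "z \<in> mcarrier ?P"
    have "z \<in> fiber_product E \<pi>" by (rule subsetD [OF mcarrier_submanifold_atlas z])
    then have "fst z \<in> mcarrier E" by (auto simp: fiber_product_def)
    then obtain U \<psi> where U: "group_trivialization E \<pi> M GA U \<psi> G grp" "fst z \<in> trivialization.total E \<pi> U"
      using triv by blast
    then interpret group_trivialization E \<pi> M GA U \<psi> G grp by blast
    show "smooth_at ?P E (\<lambda>(g, h). g \<otimes>\<^bsub>grp (\<pi> g)\<^esub> h) z"
      using z U(2) by (rule smooth_at_fiber_product_mult)
  qed
  show ?thesis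
    unfolding lie_groupoid_def comp
    using mf proj grpd subm unit inver emb mult by (simp add: canonical_groupoid_def)
qed

theorem proposition4p2:
  fixes GA :: "('g, 'n::model_space) atlas" and G :: "'g monoid" and \<omega> :: "('g, 'n) form2"
    and E :: "('x, 'e::model_space) atlas" and \<pi> :: "'x \<Rightarrow> 'b"
    and M :: "('b, 'm::model_space) atlas" and grp :: "'b \<Rightarrow> 'x monoid"
    and \<omega>' :: "('x, 'e) form2"
  assumes "symplectic_lie_group_bundle GA G \<omega> E \<pi> M grp \<omega>'"
  shows "t_symplectic_lie_groupoid TYPE('n) (canonical_groupoid E \<pi> M grp) \<omega>'"
proof -
  let ?\<Gamma> = "canonical_groupoid E \<pi> M grp"
  have sec: "smooth_section2 E (ker_tangent E M \<pi>) \<omega>'" and proj: "\<pi> ` mcarrier E = mcarrier M"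
    using assms by (simp_all add: symplectic_lie_group_bundle_def smooth_fiber_bundle_def)
  have fib: "carrier (grp p) = fiber E \<pi> p" "embedded_submanifold TYPE('n) E (fiber E \<pi> p)"
    "smooth_manifold (submanifold_atlas E (fiber E \<pi> p) :: ('x, 'n) atlas)"
    "symplectic_form (submanifold_atlas E (fiber E \<pi> p) :: ('x, 'n) atlas)
      (restrict_form2 E (fiber E \<pi> p) \<omega>')"
    "left_invariant_form (submanifold_atlas E (fiber E \<pi> p) :: ('x, 'n) atlas) (grp p)
      (restrict_form2 E (fiber E \<pi> p) \<omega>')" if "p \<in> mcarrier M" for p
    using assms that by (simp_all add: symplectic_lie_group_bundle_def lie_group_def)
  have "left_invariant_section TYPE('n) ?\<Gamma> \<omega>'"
    unfolding left_invariant_section_def Let_def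
  proof
    fix g assume "g \<in> mcarrier (arr ?\<Gamma>)"
    then have g: "g \<in> mcarrier E" "\<pi> g \<in> mcarrier M" using proj by (auto simp: canonical_groupoid_def)
    then have "g \<in> carrier (grp (\<pi> g))" by (simp add: fib(1) fiber_def)
    with fib(5) [OF g(2)]
    show "form2_eq (submanifold_atlas (arr ?\<Gamma>) (target_fiber ?\<Gamma> (src ?\<Gamma> g)) :: ('x, 'n) atlas)
        (pullback2 (submanifold_atlas (arr ?\<Gamma>) (target_fiber ?\<Gamma> (src ?\<Gamma> g)))
          (submanifold_atlas (arr ?\<Gamma>) (target_fiber ?\<Gamma> (tgt ?\<Gamma> g)) :: ('x, 'n) atlas)
          (\<lambda>h. mul ?\<Gamma> g h) (restrict_form2 (arr ?\<Gamma>) (target_fiber ?\<Gamma> (tgt ?\<Gamma> g)) \<omega>'))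
        (restrict_form2 (arr ?\<Gamma>) (target_fiber ?\<Gamma> (src ?\<Gamma> g)) \<omega>')"
      by (simp add: canonical_groupoid_def target_fiber_def left_invariant_form_def)
  qed
  with lie_groupoid_of_bundle [OF assms] sec fib show ?thesis
    by (simp add: t_symplectic_lie_groupoid_def canonical_groupoid_def target_fiber_def
        symplectic_manifold_def)
qed

end
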